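(* Let $z\in\mathbb{C}\setminus(-\infty,1]$ and $\alpha,\beta,\gamma\in\mathbb{C}^\ast$ such that $\Re\alpha>0$, $\Re\gamma>-1$, $\Re(\gamma+\beta)>-1$, $\beta\ne-\frac12$, and $\alpha+\gamma,\ \alpha+\beta+\gamma\notin\{-1,-2,-3,\ldots\}$. Put $E:=E(z,w):=\dfrac{z^2+w^2}{2wz}$. Then $$Q_\gamma^{(\alpha,\beta)}(2z^2-1)=\frac{e^{-i\pi(\beta+\frac12)}2^{\alpha+\beta+1}\sqrt{\pi}\,\Gamma(\beta+\frac12)\Gamma(\alpha+\gamma+1)\Gamma(\alpha+\beta+\gamma+1)z^{\alpha-\beta-1}}{\Gamma(\alpha)\Gamma(\gamma+1)\Gamma(\alpha+\beta)\Gamma(\beta+\gamma+1)(z^2-1)^\alpha}\int_{z}^\infty Q_\gamma^{(\alpha,\beta)}(2w^2-1)\,w^{\alpha+\beta}(E^2-1)^{\frac12(\alpha-\beta-1)}D_{\alpha-\beta-1}^{\beta+\frac12}\!\left(\frac{E}{\sqrt{E^2-1}}\right)dw$$ $$=\frac{e^{-i\pi\beta}2^{\alpha+1}\Gamma(\alpha+\gamma+1)\Gamma(\alpha+\beta+\gamma+1)z^{\alpha-\beta-1}}{\Gamma(\alpha)\Gamma(\gamma+1)\Gamma(\alpha+\beta)\Gamma(\beta+\gamma+1)(z^2-1)^{\alpha}}\int_{z}^\infty Q_\gamma^{(\alpha,\beta)}(2w^2-1)\,w^{\alpha+\beta}(E^2-1)^{\frac12(\alpha-1)}Q_{\alpha-1}^{\beta}\!\left(\frac{E}{\sqrt{E^2-1}}\right)dw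 .$$
   Context: $\mathbb{C}^\ast=\mathbb{C}\setminus\{0\}$. Let $\mathbf{F}(a,b;c;z)=\sum_{n\ge0}\frac{(a)_n(b)_n}{\Gamma(c+n)}\frac{z^n}{n!}$ (continued analytically to $\mathbb{C}\setminus[1,\infty)$) be the regularized Gauss hypergeometric function. For $z\in\mathbb{C}\setminus(-\infty,1]$: Jacobi function of the second kind: $Q_\gamma^{(\alpha,\beta)}(z)=\frac{2^{\alpha+\beta+\gamma}\Gamma(\alpha+\gamma+1)\Gamma(\beta+\gamma+1)}{(z-1)^{\alpha+\gamma+1}(z+1)^\beta}\mathbf{F}\big(\gamma+1,\alpha+\gamma+1;\alpha+\beta+2\gamma+2;\frac{2}{1-z}\big)$. Gegenbauer function of the second kind: $D_\lambda^\alpha(z)=\frac{e^{i\pi\alpha}\Gamma(\lambda+2\alpha)}{\Gamma(\alpha)(2z)^{\lambda+2\alpha}}\mathbf{F}\big(\frac{\lambda}{2}+\alpha,\frac{\lambda}{2}+\alpha+\frac12;\lambda+\alpha+1;\frac1{z^2}\big)$ for $|z|>1$, continued analytically. Associated Legendre function of the second kind: $Q_\nu^\mu(z)=\frac{\sqrt\pi\,e^{i\pi\mu}\Gamma(\nu+\mu+1)(z^2-1)^{\mu/2}}{2^{\nu+1}z^{\nu+\mu+1}}\mathbf{F}\big(\frac{\nu+\mu+1}{2},\frac{\nu+\mu+2}{2};\nu+\frac32;\frac1{z^2}\big)$ for $|z|>1$, continued analytically. Convention: the basic range is $z>1$ real (integration along the real axis, all powers and roots of positive numbers positive); for complex $z$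 both sides are understood by analytic continuation. Parameters are assumed such that all Gamma factors and functions are defined. *)

theory Defs
  imports "HOL-Complex_Analysis.Complex_Analysis"
begin

text \<open>
  Terms of the regularized Gauss series. The factor \<open>1 / \<Gamma>(c + n)\<close> is the entire function
  \<^const>\<open>rGamma\<close>, so that \<open>c\<close> is unrestricted.
\<close>

definition hyp2F1_reg_term :: "complex \<Rightarrow> complex \<Rightarrow> complex \<Rightarrow> complex \<Rightarrow> nat \<Rightarrow> complex" where
  "hyp2F1_reg_term a b c z n =
     pochhammer a n * pochhammer b n * rGamma (c + of_nat n) * z ^ n / fact n"

text \<open>
  The description operator is well behaved on the cut plane: the function \<open>F\<close> exists there by
  classical theory, and it is unique because the cut plane is connected. On the cut
  \<open>[1, \<infinity>)\<close> itself the value is unspecified.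
\<close>

definition hyp2F1_reg :: "complex \<Rightarrow> complex \<Rightarrow> complex \<Rightarrow> complex \<Rightarrow> complex" where
  "hyp2F1_reg a b c z =
     (THE y. \<exists>F. F holomorphic_on (- complex_of_real ` {1..}) \<and>
                 (\<forall>u. norm u < 1 \<longrightarrow> hyp2F1_reg_term a b c u sums F u) \<and>
                 y = F z)"

text \<open>
  All three functions below are meant on \<open>\<complex> \<setminus> (-\<infinity>, 1]\<close>, with principal powers.
\<close>

definition jacobi_Q :: "complex \<Rightarrow> complex \<Rightarrow> complex \<Rightarrow> complex \<Rightarrow> complex" where
  "jacobi_Q \<gamma> \<alpha> \<beta> z =
     2 powr (\<alpha> + \<beta> + \<gamma>) * Gamma (\<alpha> + \<gamma> + 1) * Gamma (\<beta> + \<gamma> + 1) /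
       ((z - 1) powr (\<alpha> + \<gamma> + 1) * (z + 1) powr \<beta>) *
     hyp2F1_reg (\<gamma> + 1) (\<alpha> + \<gamma> + 1) (\<alpha> + \<beta> + 2 * \<gamma> + 2) (2 / (1 - z))"

text \<open>
  In the next two definitions \<open>1 / z\<^sup>2 \<in> [1, \<infinity>)\<close> only for \<open>z \<in> [-1, 1]\<close>, so with the continued
  hypergeometric function the formula for \<open>\<bar>z\<bar> > 1\<close> is also its analytic continuation to
  \<open>\<complex> \<setminus> (-\<infinity>, 1]\<close>. For the same reason \<open>(z\<^sup>2 - 1)\<^bsup>\<mu>/2\<^esup>\<close> is written as
  \<open>(z - 1)\<^bsup>\<mu>/2\<^esup> (z + 1)\<^bsup>\<mu>/2\<^esup>\<close>, which has no discontinuity on the imaginary axis and is positive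
  for \<open>z > 1\<close> and real \<open>\<mu>\<close>.
\<close>

definition gegenbauer_D :: "complex \<Rightarrow> complex \<Rightarrow> complex \<Rightarrow> complex" where
  "gegenbauer_D \<nu> \<alpha> z =
     exp (\<i> * of_real pi * \<alpha>) * Gamma (\<nu> + 2 * \<alpha>) /
       (Gamma \<alpha> * (2 * z) powr (\<nu> + 2 * \<alpha>)) *
     hyp2F1_reg (\<nu> / 2 + \<alpha>) (\<nu> / 2 + \<alpha> + 1 / 2) (\<nu> + \<alpha> + 1) (1 / z\<^sup>2)"

definition legendre_Q :: "complex \<Rightarrow> complex \<Rightarrow> complex \<Rightarrow> complex" where
  "legendre_Q \<nu> \<mu> z =
     of_real (sqrt pi) * exp (\<i> * of_real pi * \<mu>) * Gamma (\<nu> + \<mu> + 1) *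
       ((z - 1) powr (\<mu> / 2) * (z + 1) powr (\<mu> / 2)) /
       (2 powr (\<nu> + 1) * z powr (\<nu> + \<mu> + 1)) *
     hyp2F1_reg ((\<nu> + \<mu> + 1) / 2) ((\<nu> + \<mu> + 2) / 2) (\<nu> + 3 / 2) (1 / z\<^sup>2)"

definition E :: "complex \<Rightarrow> complex \<Rightarrow> complex" where
  "E z w = (z\<^sup>2 + w\<^sup>2) / (2 * w * z)"

definition gegenbauer_integrand ::
    "complex \<Rightarrow> complex \<Rightarrow> complex \<Rightarrow> complex \<Rightarrow> complex \<Rightarrow> complex" where
  "gegenbauer_integrand \<alpha> \<beta> \<gamma> z w =
     jacobi_Q \<gamma> \<alpha> \<beta> (2 * w\<^sup>2 - 1) * w powr (\<alpha> + \<beta>) *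
     ((E z w)\<^sup>2 - 1) powr ((\<alpha> - \<beta> - 1) / 2) *
     gegenbauer_D (\<alpha> - \<beta> - 1) (\<beta> + 1 / 2) (E z w / csqrt ((E z w)\<^sup>2 - 1))"

definition legendre_integrand ::
    "complex \<Rightarrow> complex \<Rightarrow> complex \<Rightarrow> complex \<Rightarrow> complex \<Rightarrow> complex" where
  "legendre_integrand \<alpha> \<beta> \<gamma> z w =
     jacobi_Q \<gamma> \<alpha> \<beta> (2 * w\<^sup>2 - 1) * w powr (\<alpha> + \<beta>) *
     ((E z w)\<^sup>2 - 1) powr ((\<alpha> - 1) / 2) *
     legendre_Q (\<alpha> - 1) \<beta> (E z w / csqrt ((E z w)\<^sup>2 - 1))"

definition cut_plane :: "complex set" where
  "cut_plane = - complex_of_real ` {..1}"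

text \<open>
  \<open>g\<close> is the analytic continuation to \<open>\<complex> \<setminus> (-\<infinity>, 1]\<close> of the function \<open>f\<close> given on \<open>(1, \<infinity>)\<close>.
  By the identity theorem there is at most one such \<open>g\<close> on \<^const>\<open>cut_plane\<close>.
\<close>

definition continues :: "(complex \<Rightarrow> complex) \<Rightarrow> (real \<Rightarrow> complex) \<Rightarrow> bool" where
  "continues g f \<longleftrightarrow> g holomorphic_on cut_plane \<and> (\<forall>x>1. g (complex_of_real x) = f x)"

end

theory Submission
  imports Defs
begin

text \<open>
  By analytic continuation it suffices to treat real \<open>x > 1\<close>. There the Gegenbauer and Legendre kernels
  are multiples of one Gauss function, with argument \<open>s\<^sup>2\<close> for \<open>s = (w\<^sup>2 - x\<^sup>2) / (w\<^sup>2 + x\<^sup>2)\<close>. A quadratic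
  transformation turns this function into an Euler integral that depends on \<open>t = x\<^sup>2 / w\<^sup>2\<close>, and this
  integral is the multiplicative convolution of the beta weights \<open>v\<^bsup>\<gamma>\<^esup> (1 - v)\<^bsup>\<alpha>-1\<^esup>\<close> and
  \<open>u\<^bsup>\<beta>+\<gamma>\<^esup> (1 - u)\<^bsup>\<alpha>-1\<^esup>\<close>. One Pfaff transformation expands the Jacobi function under the integral in
  powers of \<open>1 / w\<^sup>2\<close>; integrating termwise multiplies the coefficients by two Beta values, and the result
  is the expansion given by the other Pfaff transformation.
\<close>

text \<open>The Gauss function of the kernels has parameters \<open>\<kappa> / 2\<close>,
  \<open>(\<kappa> + 1) / 2\<close>, \<open>\<alpha> + 1 / 2\<close> with \<kappa> = \<alpha> +
  \<beta>. The hypotheses bound Re \<beta> neither from above nor so as to make Re (\<alpha> +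
  \<beta>) positive, so Euler's integral in these parameters may diverge. In the symmetric Euler
  integral \<kappa> is only an exponent of a nonvanishing base, and Re \<alpha> > 0 suffices. The
  convolution is the right form because t^n is multiplicative: the moments of the two weights
  factor, and each replaces a numerator parameter \<alpha> + p of the series by p. Of the two Pfaff
  forms, the one under the integral carries no power of w^2 - 1; the other one leaves exactly the
  factor (z^2 - 1)^(-\<alpha>) of the claim. The description operator behind
  \<open>hyp2F1_reg\<close> yields a known value only after a holomorphic function on the whole cut
  plane with the right Taylor series is exhibited; the two kinds of Euler integral are these
  witnesses.\<close>

subsection \<open>Integrals depending on a parameter\<close>

text \<open>Differentiation under the integral sign. The weight \<phi> is merely integrable, so all
  regularity is put on f: a locally uniform bound B on its derivative dominates the difference
  quotients by B |\<phi>| through the mean value inequality.\<close>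

lemma holomorphic_on_parametric_integral:
  fixes f f' :: "complex \<Rightarrow> 'a \<Rightarrow> complex" and \<phi> :: "'a \<Rightarrow> complex"
  assumes "open A"
    and int: "\<And>z. z \<in> A \<Longrightarrow> integrable M (\<lambda>t. \<phi> t * f z t)"
    and \<phi>: "integrable M \<phi>"
    and f' [measurable]: "\<And>z. z \<in> A \<Longrightarrow> f' z \<in> borel_measurable M"
    and deriv: "\<And>z t. z \<in> A \<Longrightarrow> t \<in> space M \<Longrightarrow>
                  ((\<lambda>z. f z t) has_field_derivative f' z t) (at z)"
    and bound: "\<And>z. z \<in> A \<Longrightarrow> \<exists>r>0. \<exists>B. ball z r \<subseteq> A \<and>
                  (\<forall>u\<in>ball z r. \<forall>t\<in>space M. norm (f' u t) \<le> B)"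
  shows "(\<lambda>z. \<integral>t. \<phi> t * f z t \<partial>M) holomorphic_on A"
proof -
  have "((\<lambda>z. \<integral>t. \<phi> t * f z t \<partial>M) has_field_derivative (\<integral>t. \<phi> t * f' z t \<partial>M)) (at z)"
    if z: "z \<in> A" for z
    unfolding has_field_derivative_iff
  proof (subst tendsto_at_iff_sequentially, intro allI impI)
    obtain r B where r: "r > 0" "ball z r \<subseteq> A"
      and B: "\<And>u t. u \<in> ball z r \<Longrightarrow> t \<in> space M \<Longrightarrow> norm (f' u t) \<le> B"
      using bound[OF z] by blast
    fix X :: "nat \<Rightarrow> complex"
    assume X: "\<forall>i. X i \<in> UNIV - {z}" "X \<longlonglongrightarrow> z"
    have "eventually (\<lambda>n. X n \<in> ball z r) sequentially"
      using X(2) r(1) by (auto simp: tendsto_iff dist_commute)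
    then obtain N where N: "\<And>n. n \<ge> N \<Longrightarrow> X n \<in> ball z r"
      by (auto simp: eventually_sequentially)
    \<comment> \<open>This tail of X lies in the ball entirely: the domination has to hold for every
      index, not just eventually.\<close>
    define Y where "Y n = X (n + N)" for n
    have Y: "Y n \<in> ball z r" "Y n \<noteq> z" "Y n \<in> A" for n
      using N[of "n + N"] X(1) r(2) unfolding Y_def by auto
    have Ylim: "Y \<longlonglongrightarrow> z"
      unfolding Y_def by (rule LIMSEQ_ignore_initial_segment[OF X(2)])
    have "(\<lambda>n. \<integral>t. \<phi> t * ((f (Y n) t - f z t) / (Y n - z)) \<partial>M) \<longlonglongrightarrow> (\<integral>t. \<phi> t * f' z t \<partial>M)"
    proof (rule integral_dominated_convergence)
      have [measurable]: "\<phi> \<in> borel_measurable M" using \<phi> by auto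
      show "(\<lambda>t. \<phi> t * f' z t) \<in> borel_measurable M" using z by measurable
      have [measurable]: "(\<lambda>t. \<phi> t * f u t) \<in> borel_measurable M" if "u \<in> A" for u
        using int[OF that] by auto
      have "(\<lambda>t. (\<phi> t * f (Y n) t - \<phi> t * f z t) / (Y n - z)) \<in> borel_measurable M" for n
        using Y(3)[of n] z by measurable
      thus "(\<lambda>t. \<phi> t * ((f (Y n) t - f z t) / (Y n - z))) \<in> borel_measurable M" for n
        by (simp add: algebra_simps)
      show "integrable M (\<lambda>t. B * norm (\<phi> t))" using \<phi> by simp
      show "AE t in M. (\<lambda>n. \<phi> t * ((f (Y n) t - f z t) / (Y n - z))) \<longlonglongrightarrow> \<phi> t * f' z t"
      proof (rule AE_I2)
        fix t assume t: "t \<in> space M"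
        have "((\<lambda>u. (f u t - f z t) / (u - z)) \<longlongrightarrow> f' z t) (at z)"
          using deriv[OF z t] by (simp add: has_field_derivative_iff)
        hence "(\<lambda>n. (f (Y n) t - f z t) / (Y n - z)) \<longlonglongrightarrow> f' z t"
          by (subst (asm) tendsto_at_iff_sequentially) (use Y Ylim in \<open>auto simp: o_def\<close>)
        thus "(\<lambda>n. \<phi> t * ((f (Y n) t - f z t) / (Y n - z))) \<longlonglongrightarrow> \<phi> t * f' z t"
          by (intro tendsto_intros)
      qed
      show "AE t in M. norm (\<phi> t * ((f (Y n) t - f z t) / (Y n - z))) \<le> B * norm (\<phi> t)" for n
      proof (rule AE_I2)
        fix t assume t: "t \<in> space M"
        have "norm (f (Y n) t - f z t) \<le> B * norm (Y n - z)"
        proof (rule field_differentiable_bound)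
          show "convex (ball z r)" by simp
          show "((\<lambda>u. f u t) has_field_derivative f' u t) (at u within ball z r)"
            if "u \<in> ball z r" for u
            using deriv[of u t] that r(2) t by (meson has_field_derivative_at_within subsetD)
        qed (use Y(1)[of n] B t r(1) in auto)
        hence "norm ((f (Y n) t - f z t) / (Y n - z)) \<le> B"
          using Y(2)[of n] by (simp add: norm_divide field_simps)
        from mult_left_mono[OF this norm_ge_zero[of "\<phi> t"]]
        show "norm (\<phi> t * ((f (Y n) t - f z t) / (Y n - z))) \<le> B * norm (\<phi> t)"
          unfolding norm_mult by (simp add: mult_ac)
      qed
    qed
    also have "(\<lambda>n. \<integral>t. \<phi> t * ((f (Y n) t - f z t) / (Y n - z)) \<partial>M) =
      (\<lambda>n. ((\<integral>t. \<phi> t * f (Y n) t \<partial>M) - (\<integral>t. \<phi> t * f z t \<partial>M)) / (Y n - z))"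
    proof
      fix n
      show "(\<integral>t. \<phi> t * ((f (Y n) t - f z t) / (Y n - z)) \<partial>M) =
            ((\<integral>t. \<phi> t * f (Y n) t \<partial>M) - (\<integral>t. \<phi> t * f z t \<partial>M)) / (Y n - z)"
        by (subst Bochner_Integration.integral_diff[OF int int, OF Y(3) z, symmetric],
            subst integral_divide_zero[symmetric]) (simp add: algebra_simps)
    qed
    finally have lim: "(\<lambda>n. ((\<integral>t. \<phi> t * f (Y n) t \<partial>M) - (\<integral>t. \<phi> t * f z t \<partial>M)) / (Y n - z))
                     \<longlonglongrightarrow> (\<integral>t. \<phi> t * f' z t \<partial>M)" .
    show "((\<lambda>u. ((\<integral>t. \<phi> t * f u t \<partial>M) - (\<integral>t. \<phi> t * f z t \<partial>M)) / (u - z)) \<circ> X)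
                     \<longlonglongrightarrow> (\<integral>t. \<phi> t * f' z t \<partial>M)"
      by (rule LIMSEQ_offset[of _ N]) (use lim in \<open>simp only: Y_def o_def\<close>)
  qed
  thus ?thesis
    using \<open>open A\<close> by (auto simp: holomorphic_on_def field_differentiable_def
                            intro: has_field_derivative_at_within)
qed

text \<open>The bound is asked only where \<phi> is nonzero: the weights below vanish off (0, 1),
  where g may be unbounded.\<close>

lemma integrable_mult_bounded:
  fixes \<phi> g :: "'a \<Rightarrow> complex"
  assumes \<phi>: "integrable M \<phi>" and [measurable]: "g \<in> borel_measurable M"
    and "\<And>t. t \<in> space M \<Longrightarrow> \<phi> t \<noteq> 0 \<Longrightarrow> norm (g t) \<le> B"
  shows "integrable M (\<lambda>t. \<phi> t * g t)"
proof (rule Bochner_Integration.integrable_bound)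
  show "integrable M (\<lambda>t. \<phi> t * complex_of_real B)" using \<phi> by simp
  show "(\<lambda>t. \<phi> t * g t) \<in> borel_measurable M" using \<phi> by measurable
  have "norm (\<phi> t) * norm (g t) \<le> norm (\<phi> t) * \<bar>B\<bar>" if "t \<in> space M" for t
    using assms(3)[OF that] by (cases "\<phi> t = 0") (auto intro!: mult_left_mono)
  thus "AE t in M. norm (\<phi> t * g t) \<le> norm (\<phi> t * complex_of_real B)"
    by (intro AE_I2) (simp add: norm_mult)
qed

lemma continuous_on_powr_const:
  fixes f :: "'a::topological_space \<Rightarrow> complex"
  assumes "continuous_on S f" and "\<And>x. x \<in> S \<Longrightarrow> f x \<notin> \<real>\<^sub>\<le>\<^sub>0"
  shows "continuous_on S (\<lambda>x. f x powr a)"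
proof (rule continuous_on_compose2[OF _ assms(1)])
  show "continuous_on (- \<real>\<^sub>\<le>\<^sub>0) (\<lambda>w :: complex. w powr a)"
    by (intro holomorphic_on_imp_continuous_on holomorphic_intros) auto
qed (use assms(2) in auto)

text \<open>The integration variable enters through h, whose values stay in a compact set I on the
  whole space; joint continuity on \<open>cball z r \<times> I\<close> then bounds the derivative
  uniformly in t. The last premise keeps the base off the branch cut.\<close>

lemma holomorphic_on_integral_powr:
  fixes h :: "'a \<Rightarrow> real" and \<phi> :: "'a \<Rightarrow> complex"
  assumes "open A" and "compact I"
    and \<phi>: "integrable M \<phi>" and [measurable]: "h \<in> borel_measurable M"
    and h: "\<And>t. t \<in> space M \<Longrightarrow> h t \<in> I"
    and A: "\<And>z \<tau>. z \<in> A \<Longrightarrow> \<tau> \<in> I \<Longrightarrow> 1 - z * of_real \<tau> \<notin> \<real>\<^sub>\<le>\<^sub>0"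
  shows "(\<lambda>z. \<integral>t. \<phi> t * (1 - z * of_real (h t)) powr a \<partial>M) holomorphic_on A"
proof (rule holomorphic_on_parametric_integral[where
         f' = "\<lambda>z t. a * (1 - z * of_real (h t)) powr (a - 1) * (- of_real (h t))"])
  have bd: "\<exists>B. \<forall>u\<in>S. \<forall>\<tau>\<in>I. norm (g u \<tau>) \<le> B"
    if "compact S" "continuous_on (S \<times> I) (\<lambda>(u, \<tau>). g u \<tau> :: complex)" for S g
  proof -
    have "bounded ((\<lambda>(u, \<tau>). g u \<tau>) ` (S \<times> I))"
      using that \<open>compact I\<close> by (intro compact_imp_bounded compact_continuous_image compact_Times)
    thus ?thesis unfolding bounded_iff by force
  qed
  show "integrable M (\<lambda>t. \<phi> t * (1 - z * of_real (h t)) powr a)" if z: "z \<in> A" for z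
  proof -
    obtain B where "\<forall>\<tau>\<in>I. norm ((1 - z * of_real \<tau>) powr a) \<le> B"
    proof -
      have "continuous_on ({z} \<times> I) (\<lambda>(z, \<tau>). (1 - z * of_real \<tau>) powr a)"
        unfolding case_prod_unfold by (intro continuous_on_powr_const continuous_intros) (use A[OF z] in auto)
      from bd[OF _ this] show ?thesis using that by auto
    qed
    thus ?thesis by (intro integrable_mult_bounded[OF \<phi>]) (use h in auto)
  qed
  show "\<exists>r>0. \<exists>B. ball z r \<subseteq> A \<and> (\<forall>u\<in>ball z r. \<forall>t\<in>space M.
          norm (a * (1 - u * of_real (h t)) powr (a - 1) * (- of_real (h t))) \<le> B)"
    if z: "z \<in> A" for z
  proof -
    obtain r where r: "r > 0" "cball z r \<subseteq> A"
      using \<open>open A\<close> z open_contains_cball by blast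
    obtain B where "\<forall>u\<in>cball z r. \<forall>\<tau>\<in>I.
        norm (a * (1 - u * of_real \<tau>) powr (a - 1) * (- of_real \<tau>)) \<le> B"
    proof -
      have "continuous_on (cball z r \<times> I)
              (\<lambda>(u, \<tau>). a * (1 - u * of_real \<tau>) powr (a - 1) * (- of_real \<tau>))"
        unfolding case_prod_unfold by (intro continuous_on_powr_const continuous_intros)
             (use A r(2) in auto)
      from bd[OF _ this] show ?thesis using that by auto
    qed
    thus ?thesis using r h by (intro exI[of _ r] conjI exI[of _ B]) auto
  qed
qed (use assms in \<open>auto intro!: derivative_eq_intros\<close>)

text \<open>Since |h| \<le> 1 on the support of the weight, absolute convergence at z dominates the
  terms by a summable sequence times |\<phi>|. Every interchange of sum and integral below rests on
  this.\<close>

lemma powser_integral: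
  fixes \<phi> h :: "'a \<Rightarrow> complex" and c :: "nat \<Rightarrow> complex"
  assumes \<phi>: "integrable M \<phi>" and [measurable]: "h \<in> borel_measurable M"
    and h: "\<And>t. t \<in> space M \<Longrightarrow> \<phi> t \<noteq> 0 \<Longrightarrow> norm (h t) \<le> 1"
    and c: "summable (\<lambda>n. norm (c n * z ^ n))"
  shows "(\<lambda>n. c n * z ^ n * (\<integral>t. \<phi> t * h t ^ n \<partial>M)) sums (\<integral>t. \<phi> t * (\<Sum>n. c n * (z * h t) ^ n) \<partial>M)"
proof -
  have [measurable]: "\<phi> \<in> borel_measurable M" using \<phi> by auto
  define f where "f n t = c n * z ^ n * (\<phi> t * h t ^ n)" for n t
  have int: "integrable M (\<lambda>t. \<phi> t * h t ^ n)" for n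
    by (rule integrable_mult_bounded[OF \<phi>, where B = 1])
       (use h in \<open>auto simp: norm_power intro!: power_le_one\<close>)
  have int': "integrable M (f n)" for n unfolding f_def using int by simp
  have le: "norm (f n t) \<le> norm (c n * z ^ n) * norm (\<phi> t)" if "t \<in> space M" for n t
  proof (cases "\<phi> t = 0")
    case False
    hence "norm (h t) ^ n \<le> 1" using h[OF that] by (intro power_le_one) auto
    hence "norm (\<phi> t) * norm (h t) ^ n \<le> norm (\<phi> t) * 1" by (intro mult_left_mono) auto
    thus ?thesis unfolding f_def norm_mult norm_power by (intro mult_left_mono) auto
  qed (simp add: f_def)
  have "(\<lambda>n. integral\<^sup>L M (f n)) sums (\<integral>t. (\<Sum>n. f n t) \<partial>M)"
  proof (rule sums_integral[OF int'])
    show "AE t in M. summable (\<lambda>n. norm (f n t))"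
      by (intro AE_I2 summable_comparison_test'[OF summable_mult2[OF c]]) (use le in auto)
    show "summable (\<lambda>n. \<integral>t. norm (f n t) \<partial>M)"
    proof (rule summable_comparison_test'[OF summable_mult2[OF c]])
      fix n
      have "(\<integral>t. norm (f n t) \<partial>M) \<le> (\<integral>t. norm (c n * z ^ n) * norm (\<phi> t) \<partial>M)"
        using \<phi> int' le by (intro integral_mono) auto
      thus "norm (\<integral>t. norm (f n t) \<partial>M) \<le> norm (c n * z ^ n) * (\<integral>t. norm (\<phi> t) \<partial>M)" by simp
    qed
  qed
  also have "(\<lambda>n. integral\<^sup>L M (f n)) = (\<lambda>n. c n * z ^ n * (\<integral>t. \<phi> t * h t ^ n \<partial>M))"
    unfolding f_def using int by simp
  also have "(\<integral>t. (\<Sum>n. f n t) \<partial>M) = (\<integral>t. \<phi> t * (\<Sum>n. c n * (z * h t) ^ n) \<partial>M)"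
  proof (rule Bochner_Integration.integral_cong)
    fix t assume t: "t \<in> space M"
    show "(\<Sum>n. f n t) = \<phi> t * (\<Sum>n. c n * (z * h t) ^ n)"
    proof (cases "\<phi> t = 0")
      case False
      have "summable (\<lambda>n. norm (c n * (z * h t) ^ n))"
      proof (rule summable_comparison_test'[OF c])
        fix n
        have "norm (h t) ^ n \<le> 1" using h[OF t False] by (intro power_le_one) auto
        from mult_left_mono[OF this, of "norm (c n * z ^ n)"]
        show "norm (norm (c n * (z * h t) ^ n)) \<le> norm (c n * z ^ n)"
          by (simp add: norm_mult norm_power power_mult_distrib mult_ac)
      qed
      hence "summable (\<lambda>n. c n * (z * h t) ^ n)" by (rule summable_norm_cancel)
      from suminf_mult[OF this, of "\<phi> t"] show ?thesis
        by (simp add: f_def power_mult_distrib mult_ac)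
    qed (simp add: f_def)
  qed simp
  finally show ?thesis .
qed

lemma binomial_series_minus:
  fixes a w :: complex
  assumes "norm w < 1"
  shows "(\<lambda>n. pochhammer a n / fact n * w ^ n) sums (1 - w) powr (- a)"
    and "summable (\<lambda>n. norm (pochhammer a n / fact n * w ^ n))"
proof -
  have *: "(\<lambda>n. pochhammer a n / fact n * w ^ n) sums (1 - w) powr (- a)" if "norm w < 1" for w
  proof -
    have "(\<lambda>n. (-a gchoose n) * (-w) ^ n) sums (1 + (-w)) powr (-a)"
      by (rule gen_binomial_complex) (use that in simp)
    also have "(\<lambda>n. (-a gchoose n) * (-w) ^ n) = (\<lambda>n. pochhammer a n / fact n * w ^ n)"
    proof
      fix n
      have "(-a gchoose n) * (-w) ^ n = ((-1) ^ n * (-1) ^ n) * (pochhammer a n / fact n * w ^ n)"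
        unfolding gbinomial_pochhammer power_minus[of w] by (simp add: field_simps)
      thus "(-a gchoose n) * (-w) ^ n = pochhammer a n / fact n * w ^ n"
        unfolding power_mult_distrib[symmetric] by simp
    qed
    finally show ?thesis by simp
  qed
  show "(\<lambda>n. pochhammer a n / fact n * w ^ n) sums (1 - w) powr (- a)" by (rule *[OF assms])
  \<comment> \<open>Convergence at a real point r beyond the modulus of w gives absolute convergence
    at w.\<close>
  obtain r where "norm w < r" "r < 1" using dense assms by blast
  moreover have "0 \<le> r" using \<open>norm w < r\<close> norm_ge_zero[of w] by linarith
  ultimately show "summable (\<lambda>n. norm (pochhammer a n / fact n * w ^ n))"
    using *[of "of_real r"] by (intro powser_insidea[of _ "of_real r"]) (auto simp: sums_iff)
qed

subsection \<open>Convolution and the Beta integral\<close>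

text \<open>Fubini, with the affine substitution u = l v + m v t in the inner integral. It serves
  twice: \<open>l v = - v\<close>, \<open>m v = 1\<close> gives the additive convolution behind the
  Beta integral; \<open>l v = 0\<close>, \<open>m v = 1 / v\<close> gives the multiplicative
  convolution of beta weights.\<close>

lemma
  fixes \<phi> \<psi> g :: "real \<Rightarrow> complex" and l m :: "real \<Rightarrow> real"
  assumes \<phi>: "integrable lborel \<phi>" and \<psi>: "integrable lborel \<psi>"
    and [measurable]: "l \<in> borel_measurable borel" "m \<in> borel_measurable borel"
                      "g \<in> borel_measurable borel"
    and m: "\<And>v. \<phi> v \<noteq> 0 \<Longrightarrow> m v \<noteq> 0"
    and g: "\<And>u v. \<phi> v \<noteq> 0 \<Longrightarrow> \<psi> u \<noteq> 0 \<Longrightarrow> norm (g ((u - l v) / m v)) \<le> B"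
  shows integrable_affine_convolution:
      "integrable lborel (\<lambda>t. (\<integral>v. \<phi> v * \<bar>m v\<bar> * \<psi> (l v + m v * t) \<partial>lborel) * g t)"
    and integral_affine_convolution:
      "(\<integral>t. (\<integral>v. \<phi> v * \<bar>m v\<bar> * \<psi> (l v + m v * t) \<partial>lborel) * g t \<partial>lborel) =
       (\<integral>v. \<phi> v * (\<integral>u. \<psi> u * g ((u - l v) / m v) \<partial>lborel) \<partial>lborel)"
proof -
  have [measurable]: "\<phi> \<in> borel_measurable borel" "\<psi> \<in> borel_measurable borel"
    using \<phi> \<psi> by auto
  define P where "P v t = \<phi> v * \<bar>m v\<bar> * \<psi> (l v + m v * t) * g t" for v t
  define h where "h v u = \<psi> u * g ((u - l v) / m v)" for v u
  \<comment> \<open>Where \<phi> vanishes m may vanish too, and both sides are 0; elsewhere division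
    by m v recovers t.\<close>
  have P_eq: "P v t = \<phi> v * (\<bar>m v\<bar> *\<^sub>R h v (l v + m v * t))" for v t
    using m[of v] by (cases "\<phi> v = 0") (simp_all add: P_def h_def scaleR_conv_of_real)
  have h: "integrable lborel (h v)" if "\<phi> v \<noteq> 0" for v
    unfolding h_def by (rule integrable_mult_bounded[OF \<psi>]) (use g that in auto)
  have h_aff: "integrable lborel (\<lambda>t. h v (l v + m v * t))"
              "(\<integral>t. \<bar>m v\<bar> *\<^sub>R h v (l v + m v * t) \<partial>lborel) = (\<integral>u. h v u \<partial>lborel)"
              "(\<integral>t. norm (\<bar>m v\<bar> *\<^sub>R h v (l v + m v * t)) \<partial>lborel) = (\<integral>u. norm (h v u) \<partial>lborel)"
    if "\<phi> v \<noteq> 0" for v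
  proof -
    show "integrable lborel (\<lambda>t. h v (l v + m v * t))"
      using h[OF that] m[OF that] by (rule lborel_integrable_real_affine)
    show "(\<integral>t. \<bar>m v\<bar> *\<^sub>R h v (l v + m v * t) \<partial>lborel) = (\<integral>u. h v u \<partial>lborel)"
      using lborel_integral_real_affine[OF m[OF that], of "h v" "l v"] by simp
    show "(\<integral>t. norm (\<bar>m v\<bar> *\<^sub>R h v (l v + m v * t)) \<partial>lborel) = (\<integral>u. norm (h v u) \<partial>lborel)"
      using lborel_integral_real_affine[OF m[OF that], of "\<lambda>u. norm (h v u)" "l v"] by simp
  qed
  have P_int: "integrable lborel (P v)" for v
    using h_aff(1)[of v] by (cases "\<phi> v = 0") (simp_all add: P_eq[abs_def])
  have P_norm: "(\<integral>t. norm (P v t) \<partial>lborel) = norm (\<phi> v) * (\<integral>u. norm (h v u) \<partial>lborel)" for v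
    using h_aff(3)[of v] by (cases "\<phi> v = 0") (simp_all add: P_eq norm_mult)
  have meas [measurable]: "(\<lambda>(v, t). P v t) \<in> borel_measurable (lborel \<Otimes>\<^sub>M lborel)"
    unfolding P_def by measurable
  \<comment> \<open>Undoing the substitution turns the inner integral of |P| into that of |h v|,
    which is at most |B| times the L1 norm of \<psi>, whatever v is.\<close>
  have int: "integrable (lborel \<Otimes>\<^sub>M lborel) (\<lambda>(v, t). P v t)"
  proof (rule lborel_pair.Fubini_integrable[OF meas], goal_cases)
    case 1
    show ?case
    proof (rule Bochner_Integration.integrable_bound)
      show "integrable lborel (\<lambda>v. norm (\<phi> v) * (\<bar>B\<bar> * (\<integral>u. norm (\<psi> u) \<partial>lborel)))"
        using \<phi> by simp
      show "(\<lambda>v. \<integral>t. norm (case (v, t) of (v, t) \<Rightarrow> P v t) \<partial>lborel) \<in> borel_measurable lborel"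
        by measurable
      show "AE v in lborel. norm (\<integral>t. norm (case (v, t) of (v, t) \<Rightarrow> P v t) \<partial>lborel)
              \<le> norm (norm (\<phi> v) * (\<bar>B\<bar> * (\<integral>u. norm (\<psi> u) \<partial>lborel)))"
      proof (rule AE_I2)
        fix v
        show "norm (\<integral>t. norm (case (v, t) of (v, t) \<Rightarrow> P v t) \<partial>lborel)
              \<le> norm (norm (\<phi> v) * (\<bar>B\<bar> * (\<integral>u. norm (\<psi> u) \<partial>lborel)))"
        proof (cases "\<phi> v = 0")
          case False
          have "(\<integral>u. norm (h v u) \<partial>lborel) \<le> (\<integral>u. \<bar>B\<bar> * norm (\<psi> u) \<partial>lborel)"
          proof (rule integral_mono)
            fix u
            show "norm (h v u) \<le> \<bar>B\<bar> * norm (\<psi> u)"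
            proof (cases "\<psi> u = 0")
              case False
              with g[OF \<open>\<phi> v \<noteq> 0\<close> this] show ?thesis
                unfolding h_def norm_mult by (subst mult.commute) (intro mult_right_mono, auto)
            qed (simp add: h_def)
          qed (use h[OF False] \<psi> in auto)
          thus ?thesis
            by (simp add: P_norm abs_mult mult_left_mono Bochner_Integration.integral_nonneg)
        qed (simp add: P_def)
      qed
    qed
  next
    case 2
    show ?case using P_int by simp
  qed
  have eq: "(\<integral>v. \<phi> v * \<bar>m v\<bar> * \<psi> (l v + m v * t) \<partial>lborel) * g t = (\<integral>v. P v t \<partial>lborel)" for t
    by (simp add: P_def)
  show "integrable lborel (\<lambda>t. (\<integral>v. \<phi> v * \<bar>m v\<bar> * \<psi> (l v + m v * t) \<partial>lborel) * g t)"
    unfolding eq using lborel_pair.integrable_snd[OF int] .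
  have "(\<integral>t. (\<integral>v. P v t \<partial>lborel) \<partial>lborel) = (\<integral>v. (\<integral>t. P v t \<partial>lborel) \<partial>lborel)"
    by (rule lborel_pair.Fubini_integral[OF int])
  also have "(\<lambda>v. \<integral>t. P v t \<partial>lborel) = (\<lambda>v. \<phi> v * (\<integral>u. h v u \<partial>lborel))"
  proof
    fix v
    show "(\<integral>t. P v t \<partial>lborel) = \<phi> v * (\<integral>u. h v u \<partial>lborel)"
    using h_aff(2)[of v]
    by (cases "\<phi> v = 0") (simp_all only: P_eq integral_mult_right_zero mult_zero_left
            Bochner_Integration.integral_zero simp_thms)
  qed
  finally show "(\<integral>t. (\<integral>v. \<phi> v * \<bar>m v\<bar> * \<psi> (l v + m v * t) \<partial>lborel) * g t \<partial>lborel) =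
       (\<integral>v. \<phi> v * (\<integral>u. \<psi> u * g ((u - l v) / m v) \<partial>lborel) \<partial>lborel)"
    unfolding eq h_def .
qed

text \<open>Extended by 0 to the whole line, so that integrals run over \<open>lborel\<close> and
  substitutions and convolutions need no bookkeeping of domains.\<close>

definition beta_weight :: "complex \<Rightarrow> complex \<Rightarrow> real \<Rightarrow> complex" where
  "beta_weight p q t =
     (if 0 < t \<and> t < 1 then of_real t powr (p - 1) * of_real (1 - t) powr (q - 1) else 0)"

lemma beta_weight_nonzeroD: "beta_weight p q t \<noteq> 0 \<Longrightarrow> 0 < t \<and> t < 1"
  by (auto simp: beta_weight_def split: if_splits)

lemma measurable_beta_weight [measurable]: "beta_weight p q \<in> borel_measurable borel"
  unfolding beta_weight_def[abs_def] by measurable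

lemma beta_weight_reflect: "beta_weight p q (1 - t) = beta_weight q p t"
  by (auto simp: beta_weight_def)

lemma integrable_beta_weight:
  assumes "Re p > 0" "Re q > 0"
  shows "integrable lborel (beta_weight p q)"
proof -
  have int: "integrable lborel (\<lambda>t. indicat_real {0..1} t *\<^sub>R (t powr (Re p - 1) * (1 - t) powr (Re q - 1)))"
    using integrable_Beta[of "Re p" "Re q"] assms unfolding set_integrable_def by simp
  show ?thesis
    by (rule Bochner_Integration.integrable_bound[OF int])
       (auto simp: beta_weight_def norm_mult norm_powr_real_powr intro!: AE_I2)
qed

lemma not_nonpos_Ints_if_Re_pos: "Re z > 0 \<Longrightarrow> z \<notin> \<int>\<^sub>\<le>\<^sub>0"
  by (auto elim!: nonpos_Ints_cases)

lemma Gamma_nonzero_if_Re_pos: "Re z > 0 \<Longrightarrow> Gamma z \<noteq> 0"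
  using not_nonpos_Ints_if_Re_pos by (auto simp: Gamma_eq_zero_iff)

lemma Gamma_plus_of_nat: "Re z > 0 \<Longrightarrow> Gamma (z + of_nat n) = pochhammer z n * Gamma z"
  using pochhammer_Gamma[OF not_nonpos_Ints_if_Re_pos, of z n] Gamma_nonzero_if_Re_pos[of z]
  by (simp add: field_simps)

lemma Gamma_integral_lborel:
  assumes "Re z > 0"
  defines "f \<equiv> (\<lambda>t. indicat_real {0<..} t *\<^sub>R (complex_of_real t powr (z - 1) * of_real (exp (- t))))"
  shows "integrable lborel f" and "integral\<^sup>L lborel f = Gamma z"
proof -
  have [measurable]: "f \<in> borel_measurable borel" unfolding f_def by measurable
  have f_eq: "f = (\<lambda>t. indicat_real {0<..} t *\<^sub>R (complex_of_real t powr (z - 1) / of_real (exp t)))"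
    unfolding f_def by (auto simp: exp_minus field_simps)
  have abs: "set_integrable lebesgue {0<..} (\<lambda>t. complex_of_real t powr (z - 1) / of_real (exp t))"
    using absolutely_integrable_Gamma_integral[of z 1] assms by simp
  thus int: "integrable lborel f"
    unfolding set_integrable_def f_eq[symmetric] by (subst (asm) integrable_completion) auto
  have "integral\<^sup>L lborel f = integral\<^sup>L lebesgue f" by (simp add: integral_completion)
  also have "\<dots> = integral {0<..} (\<lambda>t. complex_of_real t powr (z - 1) / of_real (exp t))"
    using set_lebesgue_integral_eq_integral(2)[OF abs]
    unfolding set_lebesgue_integral_def f_eq by simp
  also have "\<dots> = Gamma z"
    using Gamma_integral_complex'[OF assms(1)] by (rule integral_unique)
  finally show "integral\<^sup>L lborel f = Gamma z" .
qed

text \<open>The convolution of t^(p-1) e^(-t) and t^(q-1) e^(-t) on the half-line is the density for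
  p + q times the integral I sought; equating total masses gives I \<Gamma>(p + q) = \<Gamma>(p)
  \<Gamma>(q).\<close>

lemma integral_beta_weight:
  assumes p: "Re p > 0" and q: "Re q > 0"
  shows "(\<integral>t. beta_weight p q t \<partial>lborel) = Beta p q"
proof -
  define f where "f z t = indicat_real {0<..} t *\<^sub>R (complex_of_real t powr (z - 1) * of_real (exp (- t)))"
    for z t
  define I where "I = (\<integral>t. beta_weight p q t \<partial>lborel)"
  have f: "integrable lborel (f z)" "integral\<^sup>L lborel (f z) = Gamma z" if "Re z > 0" for z
    using Gamma_integral_lborel[OF that] unfolding f_def by auto
  \<comment> \<open>The scaling v = t x separates the variables: the powers of t combine to
    t^(p+q-1) and the exponentials to e^(-t).\<close>
  have conv: "(\<integral>v. f p v * f q (t - v) \<partial>lborel) = I * f (p + q) t" for t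
  proof (cases "t > 0")
    case True
    have "(\<integral>v. f p v * f q (t - v) \<partial>lborel) = \<bar>t\<bar> *\<^sub>R (\<integral>x. f p (0 + t * x) * f q (t - (0 + t * x)) \<partial>lborel)"
      using True by (intro lborel_integral_real_affine) auto
    also have "\<dots> = (\<integral>x. beta_weight p q x * f (p + q) t \<partial>lborel)"
      unfolding scaleR_conv_of_real
    proof (subst integral_mult_right_zero[symmetric], rule Bochner_Integration.integral_cong)
      fix x :: real
      have tx: "t - t * x = t * (1 - x)" by (simp add: algebra_simps)
      have "0 < t * x \<longleftrightarrow> 0 < x" "0 < t * (1 - x) \<longleftrightarrow> x < 1" using True by (auto simp: zero_less_mult_iff)
      moreover have "complex_of_real t * (of_real (t * x) powr (p - 1) * of_real (exp (- (t * x))) *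
                       (of_real (t * (1 - x)) powr (q - 1) * of_real (exp (- (t * (1 - x)))))) =
                     of_real x powr (p - 1) * of_real (1 - x) powr (q - 1) *
                       (of_real t powr (p + q - 1) * of_real (exp (- t)))" if "0 < x" "x < 1"
      proof -
        have 1: "complex_of_real (t * x) powr (p - 1) = of_real t powr (p - 1) * of_real x powr (p - 1)"
                "complex_of_real (t * (1 - x)) powr (q - 1) = of_real t powr (q - 1) * of_real (1 - x) powr (q - 1)"
          using True that by (simp_all add: powr_times_real flip: of_real_diff)
        have "exp (- (t * x)) * exp (- (t * (1 - x))) = exp (- t)"
          by (simp add: algebra_simps flip: exp_add)
        hence 2: "complex_of_real (exp (- (t * x))) * of_real (exp (- (t * (1 - x)))) = of_real (exp (- t))"
          by (metis of_real_mult)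
        have 3: "complex_of_real t * (of_real t powr (p - 1) * of_real t powr (q - 1)) =
                   of_real t powr (p + q - 1)"
          using True by (simp add: powr_diff powr_add)
        show ?thesis
          unfolding 1 2[symmetric] 3[symmetric] by (simp only: mult_ac)
      qed
      ultimately show "of_real \<bar>t\<bar> * (f p (0 + t * x) * f q (t - (0 + t * x))) = beta_weight p q x * f (p + q) t"
        using True by (auto simp: f_def beta_weight_def tx)
    qed simp
    finally show ?thesis by (simp add: I_def)
  next
    case False
    hence "(\<lambda>v. f p v * f q (t - v)) = (\<lambda>v. 0)" by (auto simp: f_def split: split_indicator)
    thus ?thesis using False by (simp only:) (simp add: f_def)
  qed
  have "(\<integral>t. (\<integral>v. f p v * complex_of_real \<bar>1\<bar> * f q (- v + 1 * t) \<partial>lborel) * 1 \<partial>lborel) =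
          (\<integral>v. f p v * (\<integral>u. f q u * 1 \<partial>lborel) \<partial>lborel)"
    by (rule integral_affine_convolution[where l = "\<lambda>v. - v" and m = "\<lambda>_. 1" and g = "\<lambda>_. 1" and B = 1])
       (use f p q in auto)
  hence "(\<integral>t. I * f (p + q) t \<partial>lborel) = Gamma p * Gamma q"
    using f p q by (simp flip: conv)
  hence "I * Gamma (p + q) = Gamma p * Gamma q" using f p q by simp
  moreover have "Gamma (p + q) \<noteq> 0"
    using p q by (intro Gamma_nonzero_if_Re_pos) simp
  ultimately show ?thesis unfolding I_def Beta_def by (simp add: field_simps)
qed

subsection \<open>Euler integrals and the Pfaff transformation\<close>

abbreviation gauss_cut :: "complex set" where
  "gauss_cut \<equiv> - complex_of_real ` {1..}"

lemma of_real_image_Ici: "complex_of_real ` {1..} = {z. Im z = 0 \<and> Re z \<ge> 1}"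
  by (auto simp: image_iff complex_eq_iff)

lemma open_gauss_cut: "open gauss_cut"
proof -
  have "closed {z. Im z = 0 \<and> Re z \<ge> 1}"
    by (intro closed_Collect_conj closed_Collect_eq closed_Collect_le continuous_intros)
  thus ?thesis unfolding of_real_image_Ici by (simp add: open_Compl)
qed

lemma ball_subset_gauss_cut: "ball 0 1 \<subseteq> gauss_cut"
  by auto

lemma connected_gauss_cut: "connected gauss_cut"
proof (rule starlike_imp_connected, unfold starlike_def, rule bexI, intro ballI subsetI)
  fix z y assume z: "z \<in> gauss_cut" and "y \<in> closed_segment 0 z"
  then obtain u where u: "y = of_real u * z" "0 \<le> u" "u \<le> 1"
    by (auto simp: closed_segment_def scaleR_conv_of_real)
  show "y \<in> gauss_cut"
  proof
    assume "y \<in> complex_of_real ` {1..}"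
    hence y: "u * Im z = 0" "u * Re z \<ge> 1" using u unfolding of_real_image_Ici by auto
    hence "u \<noteq> 0" by auto
    moreover from this y have "Re z \<ge> 0" using u(2) by (smt (verit) mult_nonneg_nonpos)
    hence "u * Re z \<le> Re z" using u by (simp add: mult_left_le_one_le)
    ultimately show False using y z unfolding of_real_image_Ici by auto
  qed
qed (auto simp: image_iff)

text \<open>F settles the existence part of the description. Any competitor has the same series on
  the unit disc and therefore agrees with F on the connected set \<open>gauss_cut\<close> by the
  identity theorem.\<close>

lemma hyp2F1_reg_eqI:
  assumes "F holomorphic_on gauss_cut"
    and "\<And>u. norm u < 1 \<Longrightarrow> hyp2F1_reg_term a b c u sums F u"
    and z: "z \<in> gauss_cut"
  shows "hyp2F1_reg a b c z = F z"
  unfolding hyp2F1_reg_def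
proof (rule the_equality)
  fix y assume "\<exists>G. G holomorphic_on gauss_cut \<and>
    (\<forall>u. norm u < 1 \<longrightarrow> hyp2F1_reg_term a b c u sums G u) \<and> y = G z"
  then obtain G where G: "G holomorphic_on gauss_cut"
    "\<And>u. norm u < 1 \<Longrightarrow> hyp2F1_reg_term a b c u sums G u" "y = G z" by blast
  have "G z = F z"
  proof (rule analytic_continuation_open[of "ball 0 1" gauss_cut G F])
    show "G w = F w" if "w \<in> ball 0 1" for w
      using that assms(2)[of w] G(2)[of w] by (auto intro: sums_unique2)
  qed (use assms G(1) open_gauss_cut connected_gauss_cut ball_subset_gauss_cut in auto)
  with G(3) show "y = F z" by simp
qed (use assms in blast)

lemma hyp2F1_reg_commute: "hyp2F1_reg a b c z = hyp2F1_reg b a c z"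
proof -
  have "hyp2F1_reg_term a b c = hyp2F1_reg_term b a c"
    by (auto simp: hyp2F1_reg_term_def fun_eq_iff)
  thus ?thesis by (simp add: hyp2F1_reg_def)
qed

text \<open>For Re p, Re q > 0 this is \<Gamma>(p) \<Gamma>(q) times the regularized Gauss function
  with numerator parameters a, p and denominator parameter p + q.\<close>

definition euler_integral :: "complex \<Rightarrow> complex \<Rightarrow> complex \<Rightarrow> complex \<Rightarrow> complex" where
  "euler_integral a p q z = (\<integral>t. beta_weight p q t * (1 - z * of_real t) powr (-a) \<partial>lborel)"

lemma beta_weight_times_power: "beta_weight p q t * of_real t ^ n = beta_weight (p + of_nat n) q t"
proof -
  have "of_real t powr (p + of_nat n - 1) = of_real t powr (p - 1) * of_real t ^ n" if "t > 0"
  proof -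
    have "complex_of_real t powr (p + of_nat n - 1) = of_real t powr (p - 1 + of_nat n)"
      by (simp add: algebra_simps)
    also have "\<dots> = of_real t powr (p - 1) * of_real t ^ n"
      using that by (simp only: powr_add powr_nat) simp
    finally show ?thesis .
  qed
  thus ?thesis by (simp add: beta_weight_def)
qed

text \<open>Each integration against a beta weight multiplies the n-th coefficient by a moment; two
  such steps carry the final computation.\<close>

lemma beta_weight_powser:
  assumes p: "Re p > 0" and q: "Re q > 0" and c: "summable (\<lambda>n. norm (c n * z ^ n))"
  shows "(\<lambda>n. c n * z ^ n * Beta (p + of_nat n) q) sums
           (\<integral>t. beta_weight p q t * (\<Sum>n. c n * (z * of_real t) ^ n) \<partial>lborel)"
proof -
  have "(\<lambda>n. c n * z ^ n * (\<integral>t. beta_weight p q t * of_real t ^ n \<partial>lborel)) sums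
           (\<integral>t. beta_weight p q t * (\<Sum>n. c n * (z * of_real t) ^ n) \<partial>lborel)"
    by (rule powser_integral[OF integrable_beta_weight[OF p q] _ _ c]) (auto dest: beta_weight_nonzeroD)
  also have "(\<lambda>n. c n * z ^ n * (\<integral>t. beta_weight p q t * of_real t ^ n \<partial>lborel)) =
             (\<lambda>n. c n * z ^ n * Beta (p + of_nat n) q)"
    using p q by (auto simp: beta_weight_times_power integral_beta_weight add_pos_nonneg fun_eq_iff)
  finally show ?thesis .
qed

lemma euler_integral_sums:
  assumes "Re p > 0" "Re q > 0" and z: "norm z < 1"
  shows "(\<lambda>n. pochhammer a n / fact n * z ^ n * Beta (p + of_nat n) q) sums euler_integral a p q z"
proof -
  have "(\<integral>t. beta_weight p q t * (\<Sum>n. pochhammer a n / fact n * (z * of_real t) ^ n) \<partial>lborel) =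
          euler_integral a p q z"
    unfolding euler_integral_def
  proof (rule Bochner_Integration.integral_cong)
    fix t
    show "beta_weight p q t * (\<Sum>n. pochhammer a n / fact n * (z * of_real t) ^ n) =
          beta_weight p q t * (1 - z * of_real t) powr (-a)"
    proof (cases "beta_weight p q t = 0")
      case False
      hence "norm (z * of_real t) < 1"
        using z mult_left_le[of "\<bar>t\<bar>" "norm z"] by (auto dest!: beta_weight_nonzeroD simp: norm_mult)
      thus ?thesis using sums_unique[OF binomial_series_minus(1)[of "z * of_real t" a]] by simp
    qed simp
  qed simp
  thus ?thesis using beta_weight_powser[OF assms(1,2) binomial_series_minus(2)[OF z, of a]]
    by (simp only:)
qed

lemma one_minus_mult_notin_nonpos_Reals:
  assumes "z \<in> gauss_cut" "0 \<le> \<tau>" "\<tau> \<le> 1"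
  shows "1 - z * of_real \<tau> \<notin> \<real>\<^sub>\<le>\<^sub>0"
proof
  assume "1 - z * of_real \<tau> \<in> \<real>\<^sub>\<le>\<^sub>0"
  hence *: "Re z * \<tau> \<ge> 1" "Im z * \<tau> = 0" by (auto simp: complex_nonpos_Reals_iff)
  moreover from * have "Re z \<ge> 0" using assms(2) by (smt (verit) mult_nonneg_nonpos2)
  hence "Re z * \<tau> \<le> Re z" using assms by (simp add: mult_left_le)
  ultimately show False using assms unfolding of_real_image_Ici by auto
qed

lemma holomorphic_on_euler_integral:
  assumes "Re p > 0" "Re q > 0"
  shows "euler_integral a p q holomorphic_on gauss_cut"
proof -
  \<comment> \<open>Clamping t to [0, 1] changes nothing where the weight is nonzero and supplies
    the compact range required for holomorphy.\<close>
  have "(\<lambda>z. \<integral>t. beta_weight p q t * (1 - z * of_real (max 0 (min 1 t))) powr (-a) \<partial>lborel)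
          holomorphic_on gauss_cut"
    by (rule holomorphic_on_integral_powr[where I = "{0..1}"])
       (use open_gauss_cut integrable_beta_weight[OF assms] one_minus_mult_notin_nonpos_Reals
        in auto)
  also have "(\<lambda>z. \<integral>t. beta_weight p q t * (1 - z * of_real (max 0 (min 1 t))) powr (-a) \<partial>lborel) =
             euler_integral a p q"
    unfolding euler_integral_def
    by (intro ext Bochner_Integration.integral_cong) (auto simp: beta_weight_def max_def min_def)
  finally show ?thesis .
qed

text \<open>The Euler integral over \<Gamma>(b) \<Gamma>(c - b) is holomorphic on the cut plane and
  has the regularized Gauss series, so it is what the description operator denotes; the series and
  the holomorphy are then read off it.\<close>

lemma
  assumes b: "Re b > 0" and cb: "Re (c - b) > 0"
  shows hyp2F1_reg_eq_euler_integral: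
      "z \<in> gauss_cut \<Longrightarrow> hyp2F1_reg a b c z = euler_integral a b (c - b) z / (Gamma b * Gamma (c - b))"
    and hyp2F1_reg_sums: "norm z < 1 \<Longrightarrow> hyp2F1_reg_term a b c z sums hyp2F1_reg a b c z"
    and holomorphic_on_hyp2F1_reg: "hyp2F1_reg a b c holomorphic_on gauss_cut"
proof -
  define F where "F z = euler_integral a b (c - b) z / (Gamma b * Gamma (c - b))" for z
  have nz: "Gamma b \<noteq> 0" "Gamma (c - b) \<noteq> 0" by (rule Gamma_nonzero_if_Re_pos[OF b], rule Gamma_nonzero_if_Re_pos[OF cb])
  have hol: "F holomorphic_on gauss_cut"
    unfolding F_def by (intro holomorphic_intros holomorphic_on_euler_integral assms) (use nz in auto)
  have sums: "hyp2F1_reg_term a b c u sums F u" if "norm u < 1" for u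
  proof -
    have "(\<lambda>n. pochhammer a n / fact n * u ^ n * Beta (b + of_nat n) (c - b) / (Gamma b * Gamma (c - b))) sums F u"
      unfolding F_def by (rule sums_divide[OF euler_integral_sums[OF assms that]])
    also have "(\<lambda>n. pochhammer a n / fact n * u ^ n * Beta (b + of_nat n) (c - b) / (Gamma b * Gamma (c - b))) =
               hyp2F1_reg_term a b c u"
    proof
      fix n
      have "b + of_nat n + (c - b) = c + of_nat n" by simp
      thus "pochhammer a n / fact n * u ^ n * Beta (b + of_nat n) (c - b) / (Gamma b * Gamma (c - b)) =
            hyp2F1_reg_term a b c u n"
        using nz unfolding Beta_altdef hyp2F1_reg_term_def Gamma_plus_of_nat[OF b]
        by (simp add: add.commute)
    qed
    finally show ?thesis .
  qed
  show eq: "hyp2F1_reg a b c z = euler_integral a b (c - b) z / (Gamma b * Gamma (c - b))"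
    if "z \<in> gauss_cut" for z
    using hyp2F1_reg_eqI[OF hol sums that] by (simp add: F_def)
  show "hyp2F1_reg a b c holomorphic_on gauss_cut"
    by (rule holomorphic_transform[OF hol]) (simp add: eq F_def)
  show "hyp2F1_reg_term a b c z sums hyp2F1_reg a b c z" if "norm z < 1"
    using hyp2F1_reg_eqI[OF hol sums, of z] sums[OF that] that ball_subset_gauss_cut by auto
qed

text \<open>Reflecting t to 1 - t in the Euler integral exchanges b and c - b. With the argument
  written as 1 / (1 - y), y > 1, all bases are positive reals, so powers multiply without branch
  corrections.\<close>

lemma hyp2F1_reg_Pfaff:
  assumes b: "Re b > 0" and cb: "Re (c - b) > 0" and y: "(y :: real) > 1"
  shows "hyp2F1_reg a b c (1 / (1 - of_real y)) =
         of_real (y / (y - 1)) powr (-a) * hyp2F1_reg a (c - b) c (1 / of_real y)"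
proof -
  define v u where "v = 1 / (1 - y)" and "u = 1 / y"
  have v: "v < 0" and u: "0 < u" "u < 1" using y by (auto simp: v_def u_def)
  have "euler_integral a b (c - b) (of_real v) =
        (\<integral>t. beta_weight b (c - b) (1 + (-1) * t) * (1 - of_real v * of_real (1 + (-1) * t)) powr (-a) \<partial>lborel)"
    unfolding euler_integral_def by (subst lborel_integral_real_affine[of "-1" _ 1]) auto
  also have "\<dots> = (\<integral>t. of_real (y / (y - 1)) powr (-a) *
                       (beta_weight (c - b) b t * (1 - of_real u * of_real t) powr (-a)) \<partial>lborel)"
  proof (rule Bochner_Integration.integral_cong)
    fix t
    have "(1 - of_real v * of_real (1 - t)) powr (-a) =
            complex_of_real (y / (y - 1)) powr (-a) * (1 - of_real u * of_real t) powr (-a)"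
      if "0 < t" "t < 1"
    proof -
      have "u * t < 1" using u that by (smt (verit) mult_le_cancel_right2)
      \<comment> \<open>This is 1 - v (1 - t) = (1 - v) (1 - u t), where u = v / (v - 1) and 1 - v =
        y / (y - 1).\<close>
      have "1 - v * (1 - t) = (y / (y - 1)) * (1 - u * t)"
        using y by (simp add: v_def u_def field_simps)
      hence "1 - complex_of_real v * of_real (1 - t) = of_real (y / (y - 1)) * of_real (1 - u * t)"
        by (metis of_real_1 of_real_diff of_real_mult)
      also have "\<dots> powr (-a) = complex_of_real (y / (y - 1)) powr (-a) * of_real (1 - u * t) powr (-a)"
        using y \<open>u * t < 1\<close> by (intro powr_times_real) auto
      finally show ?thesis by simp
    qed
    thus "beta_weight b (c - b) (1 + (-1) * t) * (1 - of_real v * of_real (1 + (-1) * t)) powr (-a) =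
          complex_of_real (y / (y - 1)) powr (-a) *
            (beta_weight (c - b) b t * (1 - of_real u * of_real t) powr (-a))"
      using beta_weight_reflect[of b "c - b" t]
      by (cases "beta_weight (c - b) b t = 0") (auto dest!: beta_weight_nonzeroD)
  qed simp
  also have "\<dots> = of_real (y / (y - 1)) powr (-a) * euler_integral a (c - b) b (of_real u)"
    by (simp add: euler_integral_def)
  finally have eq: "euler_integral a b (c - b) (of_real v) = \<dots>" .
  have vu: "of_real v \<in> gauss_cut" "of_real u \<in> gauss_cut"
    using v u unfolding of_real_image_Ici by auto
  have "hyp2F1_reg a b c (of_real v) =
        of_real (y / (y - 1)) powr (-a) * hyp2F1_reg a (c - b) c (of_real u)"
    unfolding hyp2F1_reg_eq_euler_integral[OF b cb vu(1)] eq
    by (subst hyp2F1_reg_eq_euler_integral[OF cb _ vu(2)]) (use b in \<open>auto simp: mult_ac\<close>)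
  thus ?thesis by (simp add: v_def u_def)
qed

subsection \<open>The symmetric Euler integral and the quadratic transformation\<close>

text \<open>The change of variables is available for absolute integrability over sets. Since f
  vanishes off the image, the integral over the image is the one over the whole line; the
  measurability premise allows the way back from \<open>lebesgue\<close> to
  \<open>lborel\<close>.\<close>

lemma
  fixes f :: "real \<Rightarrow> complex" and g g' :: "real \<Rightarrow> real"
  assumes S [measurable]: "S \<in> sets borel"
    and der: "\<And>x. x \<in> S \<Longrightarrow> (g has_field_derivative g' x) (at x within S)"
    and inj: "inj_on g S"
    and f: "integrable lborel f" "\<And>y. y \<notin> g ` S \<Longrightarrow> f y = 0"
    and meas: "(\<lambda>x. indicat_real S x *\<^sub>R (\<bar>g' x\<bar> *\<^sub>R f (g x))) \<in> borel_measurable borel"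
  shows set_integrable_lborel_substitution:
      "set_integrable lborel S (\<lambda>x. \<bar>g' x\<bar> *\<^sub>R f (g x))"
    and set_integral_lborel_substitution:
      "(LINT x:S|lborel. \<bar>g' x\<bar> *\<^sub>R f (g x)) = integral\<^sup>L lborel f"
proof -
  have meas_f [measurable]: "f \<in> borel_measurable borel" using f(1) by auto
  have f_ind: "indicat_real (g ` S) y *\<^sub>R f y = f y" for y
    using f(2)[of y] by (auto simp: indicator_def)
  have f_abs: "f absolutely_integrable_on g ` S"
    unfolding set_integrable_def f_ind using f(1) by (simp add: integrable_completion)
  have f_int: "integral (g ` S) f = integral\<^sup>L lborel f"
    using set_lebesgue_integral_eq_integral(2)[OF f_abs]
    unfolding set_lebesgue_integral_def f_ind by (simp add: integral_completion)
  have *: "(\<lambda>x. \<bar>g' x\<bar> *\<^sub>R f (g x)) absolutely_integrable_on S"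
          "integral S (\<lambda>x. \<bar>g' x\<bar> *\<^sub>R f (g x)) = integral\<^sup>L lborel f"
    using has_absolute_integral_change_of_variables_real[OF _ der inj, of f "integral\<^sup>L lborel f"]
          f_abs f_int S by auto
  show "set_integrable lborel S (\<lambda>x. \<bar>g' x\<bar> *\<^sub>R f (g x))"
    using *(1) meas unfolding set_integrable_def by (simp add: integrable_completion)
  have "(LINT x:S|lborel. \<bar>g' x\<bar> *\<^sub>R f (g x)) = (LINT x:S|lebesgue. \<bar>g' x\<bar> *\<^sub>R f (g x))"
    using meas unfolding set_lebesgue_integral_def by (simp add: integral_completion)
  also have "\<dots> = integral\<^sup>L lborel f"
    using set_lebesgue_integral_eq_integral(2)[OF *(1)] *(2) by simp
  finally show "(LINT x:S|lborel. \<bar>g' x\<bar> *\<^sub>R f (g x)) = integral\<^sup>L lborel f" .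
qed

section \<open>Moments of the symmetric beta weight about its midpoint\<close>

definition symmetric_moment :: "complex \<Rightarrow> nat \<Rightarrow> complex" where
  "symmetric_moment \<alpha> n = (\<integral>q. beta_weight \<alpha> \<alpha> q * of_real (1 - 2 * q) ^ n \<partial>lborel)"

lemma integral_reflect_unit:
  fixes f :: "real \<Rightarrow> complex"
  shows "(\<integral>q. f q \<partial>lborel) = (\<integral>q. f (1 - q) \<partial>lborel)"
  by (subst lborel_integral_real_affine[of "-1" _ 1]) auto

lemma norm_one_minus_twice_le:
  "beta_weight p q t \<noteq> 0 \<Longrightarrow> norm (complex_of_real (1 - 2 * t)) \<le> 1"
  unfolding norm_of_real by (drule beta_weight_nonzeroD) auto

lemma symmetric_moment_odd:
  assumes "odd n"
  shows "symmetric_moment \<alpha> n = 0"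
proof -
  have "symmetric_moment \<alpha> n = (\<integral>q. beta_weight \<alpha> \<alpha> (1 - q) * of_real (1 - 2 * (1 - q)) ^ n \<partial>lborel)"
    unfolding symmetric_moment_def by (rule integral_reflect_unit)
  also have "\<dots> = (\<integral>q. - (beta_weight \<alpha> \<alpha> q * of_real (1 - 2 * q) ^ n) \<partial>lborel)"
  proof (rule Bochner_Integration.integral_cong)
    fix q :: real
    have "complex_of_real (1 - 2 * (1 - q)) = - of_real (1 - 2 * q)" by simp
    hence "complex_of_real (1 - 2 * (1 - q)) ^ n = - (of_real (1 - 2 * q) ^ n)"
      using power_minus_odd[OF assms, of "complex_of_real (1 - 2 * q)"] by (simp only:)
    thus "beta_weight \<alpha> \<alpha> (1 - q) * of_real (1 - 2 * (1 - q)) ^ n =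
          - (beta_weight \<alpha> \<alpha> q * of_real (1 - 2 * q) ^ n)"
      by (simp add: beta_weight_reflect)
  qed simp
  also have "\<dots> = - symmetric_moment \<alpha> n" by (simp add: symmetric_moment_def)
  finally show ?thesis by simp
qed

text \<open>The substitution y = (1 - 2 q)^2 leads to a Beta integral because 1 - y = 4 q (1 - q),
  which is also the source of the power of 4. The map is injective only on half of the interval,
  hence the factor 2.\<close>

lemma symmetric_moment_even:
  assumes \<alpha>: "Re \<alpha> > 0"
  shows "symmetric_moment \<alpha> (2 * m) = 2 / 4 powr \<alpha> * Beta (of_nat m + 1 / 2) \<alpha>"
proof -
  define f where "f q = beta_weight \<alpha> \<alpha> q * of_real (1 - 2 * q) ^ (2 * m)" for q
  have int: "integrable lborel f"
    unfolding f_def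
    by (rule integrable_mult_bounded[OF integrable_beta_weight[OF \<alpha> \<alpha>], where B = 1])
       (use norm_one_minus_twice_le in \<open>auto simp del: of_real_diff simp: norm_power intro!: power_le_one\<close>)
  have refl: "f (1 - q) = f q" for q
  proof -
    have "complex_of_real (1 - 2 * (1 - q)) = - of_real (1 - 2 * q)" by simp
    hence "complex_of_real (1 - 2 * (1 - q)) ^ (2 * m) = of_real (1 - 2 * q) ^ (2 * m)"
      by (simp only: power_mult power2_minus)
    thus ?thesis unfolding f_def by (simp only: beta_weight_reflect)
  qed
  have f_0: "f q = 0" if "q \<le> 0 \<or> 1 \<le> q" for q
    using that by (auto simp: f_def beta_weight_def)
  define J where "J = (LINT q:{0<..<1/2}|lborel. f q)"
  have "symmetric_moment \<alpha> (2 * m) = (\<integral>q. f q \<partial>lborel)" by (simp add: symmetric_moment_def f_def)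
  also have "\<dots> = (\<integral>q. indicat_real {0<..<1/2} q *\<^sub>R f q + indicat_real {0<..<1/2} (1 - q) *\<^sub>R f (1 - q) \<partial>lborel)"
  \<comment> \<open>The midpoint 1/2 lies in neither half, so the splitting is an identity almost
    everywhere.\<close>
  proof (rule integral_cong_AE)
    have "AE q in lborel. q \<noteq> (1/2 :: real)" by (rule AE_lborel_singleton)
    thus "AE q in lborel. f q =
            indicat_real {0<..<1/2} q *\<^sub>R f q + indicat_real {0<..<1/2} (1 - q) *\<^sub>R f (1 - q)"
      by eventually_elim (auto simp: refl f_0 indicator_def)
  qed (simp_all add: f_def)
  also have "\<dots> = J + (\<integral>q. indicat_real {0<..<1/2} (1 - q) *\<^sub>R f (1 - q) \<partial>lborel)"
    unfolding J_def set_lebesgue_integral_def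
  proof (rule Bochner_Integration.integral_add)
    show int': "integrable lborel (\<lambda>q. indicat_real {0<..<1/2} q *\<^sub>R f q)"
      using int by (intro integrable_mult_indicator) auto
    show "integrable lborel (\<lambda>q. indicat_real {0<..<1/2} (1 - q) *\<^sub>R f (1 - q))"
      using lborel_integrable_real_affine[OF int', of "-1" 1] by simp
  qed
  also have "(\<integral>q. indicat_real {0<..<1/2} (1 - q) *\<^sub>R f (1 - q) \<partial>lborel) = J"
    unfolding J_def set_lebesgue_integral_def by (rule integral_reflect_unit[symmetric])
  finally have M: "symmetric_moment \<alpha> (2 * m) = 2 * J" by simp

  define g g' where "g q = (1 - 2 * q)\<^sup>2" and "g' q = - 4 * (1 - 2 * q)" for q :: real
  define b where "b = beta_weight (of_nat m + 1 / 2) \<alpha>"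
  have img: "g ` {0<..<1/2} = {0<..<1}"
  proof (intro equalityI subsetI)
    fix y :: real assume "y \<in> {0<..<1}"
    hence "g ((1 - sqrt y) / 2) = y" "(1 - sqrt y) / 2 \<in> {0<..<1/2}" by (auto simp: g_def diff_divide_distrib)
    thus "y \<in> g ` {0<..<1/2}" by (metis imageI)
  next
    fix y assume "y \<in> g ` {0<..<1/2}"
    then obtain q where "y = (1 - 2 * q)\<^sup>2" "0 < q" "q < 1/2" by (auto simp: g_def)
    thus "y \<in> {0<..<1}" using power_strict_mono[of "1 - 2 * q" 1 2] by auto
  qed
  have "(LINT q:{0<..<1/2}|lborel. \<bar>g' q\<bar> *\<^sub>R b (g q)) = integral\<^sup>L lborel b"
  proof (rule set_integral_lborel_substitution)
    show "inj_on g {0<..<1/2}"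
      by (rule inj_onI) (auto simp: g_def power2_eq_iff)
    show "integrable lborel b" unfolding b_def using \<alpha> by (intro integrable_beta_weight) auto
    show "b y = 0" if "y \<notin> g ` {0<..<1/2}" for y
      using that unfolding img by (auto simp: b_def beta_weight_def)
    show "(\<lambda>q. indicat_real {0<..<1/2} q *\<^sub>R (\<bar>g' q\<bar> *\<^sub>R b (g q))) \<in> borel_measurable borel"
      unfolding b_def g_def g'_def by measurable
  qed (auto simp: g_def g'_def intro!: derivative_eq_intros)
  also have "\<dots> = Beta (of_nat m + 1 / 2) \<alpha>"
    unfolding b_def using \<alpha> by (intro integral_beta_weight) auto
  also have "(LINT q:{0<..<1/2}|lborel. \<bar>g' q\<bar> *\<^sub>R b (g q)) = (LINT q:{0<..<1/2}|lborel. 4 powr \<alpha> * f q)"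
  proof (rule set_lebesgue_integral_cong)
    show "\<forall>q. q \<in> {0<..<1/2} \<longrightarrow> \<bar>g' q\<bar> *\<^sub>R b (g q) = 4 powr \<alpha> * f q"
    proof (intro allI impI)
      fix q :: real assume q: "q \<in> {0<..<1/2}"
      define r where "r = 1 - 2 * q"
      have r: "0 < r" "r < 1" using q by (auto simp: r_def)
      have gq: "g q = r * r" "0 < r * r" "r * r < 1"
        using r mult_strict_mono[of r 1 r 1] by (auto simp: g_def r_def power2_eq_square)
      have "1 - r * r = 4 * (q * (1 - q))" by (simp add: r_def algebra_simps)
      hence "complex_of_real (1 - r * r) powr (\<alpha> - 1) = of_real (4 * (q * (1 - q))) powr (\<alpha> - 1)" by simp
      also have "\<dots> = 4 powr (\<alpha> - 1) * (of_real q powr (\<alpha> - 1) * of_real (1 - q) powr (\<alpha> - 1))"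
        using q powr_times_real[of 4 "of_real (q * (1 - q))" "\<alpha> - 1"]
              powr_times_real[of "of_real q" "of_real (1 - q)" "\<alpha> - 1"]
        by simp
      finally have 1: "complex_of_real (1 - r * r) powr (\<alpha> - 1) =
           4 powr (\<alpha> - 1) * (of_real q powr (\<alpha> - 1) * of_real (1 - q) powr (\<alpha> - 1))" .
      \<comment> \<open>The Beta exponent m - 1/2 yields r^(2m - 1); the factor r of the Jacobian
        completes it to the r^(2m) of the moment.\<close>
      have "complex_of_real (r * r) powr (of_nat m + 1 / 2 - 1) =
              of_real r powr (of_nat m + 1 / 2 - 1) * of_real r powr (of_nat m + 1 / 2 - 1)"
        using r by (simp add: powr_times_real)
      also have "\<dots> = of_real r powr (of_nat (2 * m) - 1)"
        unfolding powr_add[symmetric] by simp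
      also have "\<dots> = of_real r ^ (2 * m) / of_real r"
        using r by (simp only: powr_diff powr_nat) simp
      finally have "complex_of_real (r * r) powr (of_nat m + 1 / 2 - 1) = of_real r ^ (2 * m) / of_real r" .
      hence 2: "complex_of_real r * of_real (r * r) powr (of_nat m + 1 / 2 - 1) = of_real r ^ (2 * m)"
        using r by simp
      have "\<bar>g' q\<bar> = 4 * r" using r by (simp add: g'_def r_def)
      hence "\<bar>g' q\<bar> *\<^sub>R b (g q) = 4 * (of_real r * of_real (r * r) powr (of_nat m + 1 / 2 - 1)) *
                of_real (1 - r * r) powr (\<alpha> - 1)"
        using gq by (simp add: b_def beta_weight_def scaleR_conv_of_real)
      also have "\<dots> = (4 * 4 powr (\<alpha> - 1)) * (of_real q powr (\<alpha> - 1) * of_real (1 - q) powr (\<alpha> - 1) * of_real r ^ (2 * m))"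
        unfolding 1 2 by (simp only: mult_ac)
      also have "(4 :: complex) * 4 powr (\<alpha> - 1) = 4 powr \<alpha>" by (simp add: powr_diff)
      finally show "\<bar>g' q\<bar> *\<^sub>R b (g q) = 4 powr \<alpha> * f q"
        using q by (simp add: f_def beta_weight_def r_def)
    qed
  qed simp
  also have "\<dots> = 4 powr \<alpha> * J" by (simp add: J_def)
  finally show ?thesis unfolding M by (simp add: field_simps)
qed

text \<open>For |s| < 1 this is B(\<alpha>, \<alpha>) (1 - s)^(-\<kappa>) F(\<kappa>, \<alpha>; 2
  \<alpha>; 2 s / (s - 1)). In terms of 1 - 2 q, reflecting q shows at once that it is even in
  s.\<close>

definition symmetric_euler :: "complex \<Rightarrow> complex \<Rightarrow> complex \<Rightarrow> complex" where
  "symmetric_euler \<kappa> \<alpha> s = (\<integral>q. beta_weight \<alpha> \<alpha> q * (1 - s * of_real (1 - 2 * q)) powr (-\<kappa>) \<partial>lborel)"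

lemma symmetric_euler_minus: "symmetric_euler \<kappa> \<alpha> (- s) = symmetric_euler \<kappa> \<alpha> s"
proof -
  have "symmetric_euler \<kappa> \<alpha> s =
          (\<integral>q. beta_weight \<alpha> \<alpha> (1 - q) * (1 - s * of_real (1 - 2 * (1 - q))) powr (-\<kappa>) \<partial>lborel)"
    unfolding symmetric_euler_def by (rule integral_reflect_unit)
  also have "\<dots> = symmetric_euler \<kappa> \<alpha> (- s)"
    unfolding symmetric_euler_def beta_weight_reflect
    by (intro Bochner_Integration.integral_cong) (simp_all add: algebra_simps)
  finally show ?thesis ..
qed

lemma symmetric_euler_sums:
  assumes \<alpha>: "Re \<alpha> > 0" and s: "norm s < 1"
  shows "(\<lambda>n. pochhammer \<kappa> n / fact n * s ^ n * symmetric_moment \<alpha> n) sums symmetric_euler \<kappa> \<alpha> s"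
proof -
  have "(\<lambda>n. pochhammer \<kappa> n / fact n * s ^ n * symmetric_moment \<alpha> n) sums
     (\<integral>q. beta_weight \<alpha> \<alpha> q * (\<Sum>n. pochhammer \<kappa> n / fact n * (s * of_real (1 - 2 * q)) ^ n) \<partial>lborel)"
    unfolding symmetric_moment_def
    by (rule powser_integral[OF integrable_beta_weight[OF \<alpha> \<alpha>] _ _ binomial_series_minus(2)[OF s]])
       (use norm_one_minus_twice_le in \<open>auto simp del: of_real_diff\<close>)
  also have "(\<integral>q. beta_weight \<alpha> \<alpha> q * (\<Sum>n. pochhammer \<kappa> n / fact n * (s * of_real (1 - 2 * q)) ^ n) \<partial>lborel)
               = symmetric_euler \<kappa> \<alpha> s"
    unfolding symmetric_euler_def
  proof (rule Bochner_Integration.integral_cong)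
    fix q
    show "beta_weight \<alpha> \<alpha> q * (\<Sum>n. pochhammer \<kappa> n / fact n * (s * of_real (1 - 2 * q)) ^ n) =
          beta_weight \<alpha> \<alpha> q * (1 - s * of_real (1 - 2 * q)) powr (-\<kappa>)"
    proof (cases "beta_weight \<alpha> \<alpha> q = 0")
      case False
      hence "\<bar>1 - 2 * q\<bar> \<le> 1" by (auto dest!: beta_weight_nonzeroD)
      hence "norm (s * of_real (1 - 2 * q)) < 1"
        using s mult_left_le[of "\<bar>1 - 2 * q\<bar>" "norm s"] unfolding norm_mult norm_of_real by simp
      thus ?thesis using sums_unique[OF binomial_series_minus(1)[of "s * of_real (1 - 2 * q)" \<kappa>]] by simp
    qed simp
  qed simp
  finally show ?thesis .
qed

text \<open>The domain is the preimage of \<open>gauss_cut\<close> under squaring. It omits the real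
  s with |s| \<ge> 1, for which 1 - s \<tau> meets the branch cut at some \<tau> in [-1, 1].\<close>

lemma holomorphic_on_symmetric_euler:
  assumes \<alpha>: "Re \<alpha> > 0"
  shows "symmetric_euler \<kappa> \<alpha> holomorphic_on {s. Im s = 0 \<longrightarrow> \<bar>Re s\<bar> < 1}"
proof -
  define A where "A = {s. Im s = 0 \<longrightarrow> \<bar>Re s\<bar> < 1}"
  have "closed {s. Im s = 0 \<and> \<bar>Re s\<bar> \<ge> 1}"
    by (intro closed_Collect_conj closed_Collect_eq closed_Collect_le continuous_intros)
  hence "open (- {s. Im s = 0 \<and> \<bar>Re s\<bar> \<ge> 1})" by (rule open_Compl)
  also have "- {s. Im s = 0 \<and> \<bar>Re s\<bar> \<ge> 1} = A" by (auto simp: A_def)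
  finally have "open A" .
  \<comment> \<open>As for \<open>euler_integral\<close>, clamping leaves the integrand unchanged on
    the support of the weight.\<close>
  define h where "h q = max (-1) (min 1 (1 - 2 * q))" for q :: real
  have "(\<lambda>s. \<integral>q. beta_weight \<alpha> \<alpha> q * (1 - s * of_real (h q)) powr (-\<kappa>) \<partial>lborel) holomorphic_on A"
  proof (rule holomorphic_on_integral_powr[where I = "{-1..1}"])
    fix s \<tau> assume s: "s \<in> A" and \<tau>: "\<tau> \<in> {-1..1 :: real}"
    show "1 - s * of_real \<tau> \<notin> \<real>\<^sub>\<le>\<^sub>0"
    proof
      assume "1 - s * of_real \<tau> \<in> \<real>\<^sub>\<le>\<^sub>0"
      hence *: "Re s * \<tau> \<ge> 1" "Im s * \<tau> = 0" by (auto simp: complex_nonpos_Reals_iff)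
      hence "\<bar>Re s\<bar> * \<bar>\<tau>\<bar> \<ge> 1" by (simp flip: abs_mult)
      moreover have "\<bar>Re s\<bar> * \<bar>\<tau>\<bar> \<le> \<bar>Re s\<bar>" using \<tau> by (intro mult_left_le) auto
      ultimately show False using s * by (auto simp: A_def)
    qed
  qed (use \<open>open A\<close> integrable_beta_weight[OF \<alpha> \<alpha>] in \<open>auto simp: h_def\<close>)
  also have "(\<lambda>s. \<integral>q. beta_weight \<alpha> \<alpha> q * (1 - s * of_real (h q)) powr (-\<kappa>) \<partial>lborel) =
             symmetric_euler \<kappa> \<alpha>"
    unfolding symmetric_euler_def
    by (intro ext Bochner_Integration.integral_cong) (auto simp: beta_weight_def h_def max_def min_def)
  finally show ?thesis unfolding A_def .
qed

text \<open>
  This is the quadratic transformation of \<open>F(a, a + 1/2; c; s\<^sup>2)\<close> to a function of \<open>s\<close>, in terms of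
  Euler integrals. The integral is even in \<open>s\<close>, so the branch of the square root does not matter.
\<close>

lemma hyp2F1_reg_quadratic:
  assumes \<alpha>: "Re \<alpha> > 0" and z: "z \<in> gauss_cut"
  shows "hyp2F1_reg (\<kappa> / 2) ((\<kappa> + 1) / 2) (\<alpha> + 1 / 2) z =
           4 powr \<alpha> / (2 * of_real (sqrt pi) * Gamma \<alpha>) * symmetric_euler \<kappa> \<alpha> (csqrt z)"
proof (rule hyp2F1_reg_eqI[OF _ _ z])
  \<comment> \<open>C normalizes the constant term: times the moment of order 0 it is 1 /
    \<Gamma>(\<alpha> + 1/2).\<close>
  define C where "C = 4 powr \<alpha> / (2 * of_real (sqrt pi) * Gamma \<alpha>)"
  define F where "F z = C * symmetric_euler \<kappa> \<alpha> (csqrt z)" for z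
  have \<Gamma>: "Gamma \<alpha> \<noteq> 0" by (rule Gamma_nonzero_if_Re_pos[OF \<alpha>])
  have sums: "hyp2F1_reg_term (\<kappa> / 2) ((\<kappa> + 1) / 2) (\<alpha> + 1 / 2) u sums F u" if u: "norm u < 1" for u
  proof -
    define f where "f n = pochhammer \<kappa> n / fact n * csqrt u ^ n * symmetric_moment \<alpha> n" for n
    have "norm (csqrt u) < 1"
    proof -
      have "norm (csqrt u) ^ 2 < 1 ^ 2" using u by (simp flip: norm_power)
      thus ?thesis by (rule power_less_imp_less_base) simp
    qed
    hence "f sums symmetric_euler \<kappa> \<alpha> (csqrt u)"
      unfolding f_def by (rule symmetric_euler_sums[OF \<alpha>])
    \<comment> \<open>Odd moments vanish by reflection, so only even powers of
      \<open>csqrt u\<close>, that is, powers of u, remain.\<close>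
    moreover have "f n = 0" if "n \<notin> range ((*) 2)" for n
    proof -
      have "odd n" using that by (auto elim: evenE)
      thus ?thesis by (simp add: f_def symmetric_moment_odd)
    qed
    ultimately have "(\<lambda>m. f (2 * m)) sums symmetric_euler \<kappa> \<alpha> (csqrt u)"
      by (subst sums_mono_reindex) (auto simp: strict_mono_def)
    hence "(\<lambda>m. C * f (2 * m)) sums F u"
      unfolding F_def by (rule sums_mult)
    also have "(\<lambda>m. C * f (2 * m)) = hyp2F1_reg_term (\<kappa> / 2) ((\<kappa> + 1) / 2) (\<alpha> + 1 / 2) u"
    proof
      fix m
      have half: "pochhammer (1 / 2 :: complex) m \<noteq> 0"
        using Gamma_plus_of_nat[of "1 / 2" m] Gamma_nonzero_if_Re_pos[of "1 / 2 + of_nat m"] by auto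
      \<comment> \<open>Duplication of (\<kappa>)_(2m) and of (2m)! leaves the two half parameters
        over (1/2)_m m!; the factor (1/2)_m is cancelled by \<Gamma>(m + 1/2) from the
        moment.\<close>
      have "pochhammer \<kappa> (2 * m) = of_nat (2 ^ (2 * m)) * pochhammer (\<kappa> / 2) m * pochhammer (\<kappa> / 2 + 1 / 2) m"
        using pochhammer_double[of "\<kappa> / 2" m] by simp
      also have "\<kappa> / 2 + 1 / 2 = (\<kappa> + 1) / 2" by (simp add: add_divide_distrib)
      finally have 1: "pochhammer \<kappa> (2 * m) / fact (2 * m) =
          pochhammer (\<kappa> / 2) m * pochhammer ((\<kappa> + 1) / 2) m / (pochhammer (1 / 2) m * fact m)"
        using half by (simp add: fact_double)
      have "Beta (of_nat m + 1 / 2) \<alpha> = Gamma (1 / 2 + of_nat m) * Gamma \<alpha> * rGamma (\<alpha> + 1 / 2 + of_nat m)"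
        unfolding Beta_altdef by (simp add: add_ac)
      also have "Gamma (1 / 2 + of_nat m :: complex) = pochhammer (1 / 2) m * of_real (sqrt pi)"
        by (subst Gamma_plus_of_nat) (simp_all add: Gamma_one_half_complex)
      finally have 2: "symmetric_moment \<alpha> (2 * m) = 2 / 4 powr \<alpha> *
         (pochhammer (1 / 2) m * of_real (sqrt pi) * Gamma \<alpha> * rGamma (\<alpha> + 1 / 2 + of_nat m))"
        unfolding symmetric_moment_even[OF \<alpha>] by simp
      show "C * f (2 * m) = hyp2F1_reg_term (\<kappa> / 2) ((\<kappa> + 1) / 2) (\<alpha> + 1 / 2) u m"
        unfolding f_def 1 2 hyp2F1_reg_term_def C_def power_mult power2_csqrt
        using \<Gamma> half by simp
    qed
    finally show ?thesis .
  qed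
  show "hyp2F1_reg_term (\<kappa> / 2) ((\<kappa> + 1) / 2) (\<alpha> + 1 / 2) u sums
         (4 powr \<alpha> / (2 * of_real (sqrt pi) * Gamma \<alpha>) * symmetric_euler \<kappa> \<alpha> (csqrt u))"
    if "norm u < 1" for u
    using sums[OF that] by (simp add: F_def C_def)
  have in_dom: "Im s = 0 \<longrightarrow> \<bar>Re s\<bar> < 1" if "s\<^sup>2 \<in> gauss_cut" for s :: complex
  proof (rule ccontr)
    assume "\<not> (Im s = 0 \<longrightarrow> \<bar>Re s\<bar> < 1)"
    hence "Im (s\<^sup>2) = 0" "Re (s\<^sup>2) \<ge> 1"
      using one_le_power[of "\<bar>Re s\<bar>" 2] by (auto simp: power2_eq_square)
    thus False using that unfolding of_real_image_Ici by simp
  qed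
  have hol_comp: "(\<lambda>z. symmetric_euler \<kappa> \<alpha> (g z)) holomorphic_on S"
    if "g holomorphic_on S" "S \<subseteq> gauss_cut" "\<And>z. z \<in> S \<Longrightarrow> (g z)\<^sup>2 = z" for g S
    using holomorphic_on_compose_gen[OF that(1) holomorphic_on_symmetric_euler[OF \<alpha>]] in_dom that
    by (force simp: o_def)
  \<comment> \<open>\<open>csqrt z\<close> is a holomorphic root off the nonpositive reals and
    \<open>\<i> * csqrt (- z)\<close> off the nonnegative reals; evenness makes both give the same
    F.\<close>
  have "F holomorphic_on gauss_cut \<inter> - \<real>\<^sub>\<le>\<^sub>0"
    unfolding F_def
    by (intro holomorphic_intros hol_comp) auto
  moreover have "F holomorphic_on gauss_cut \<inter> - \<real>\<^sub>\<ge>\<^sub>0"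
  proof -
    have "F = (\<lambda>z. C * symmetric_euler \<kappa> \<alpha> (\<i> * csqrt (- z)))"
    proof
      fix z
      have "(csqrt z)\<^sup>2 = (\<i> * csqrt (- z))\<^sup>2" by (simp add: power_mult_distrib)
      hence "csqrt z = \<i> * csqrt (- z) \<or> csqrt z = - (\<i> * csqrt (- z))" by (simp only: power2_eq_iff)
      thus "F z = C * symmetric_euler \<kappa> \<alpha> (\<i> * csqrt (- z))"
        unfolding F_def by (metis symmetric_euler_minus)
    qed
    moreover have "(\<lambda>z. C * symmetric_euler \<kappa> \<alpha> (\<i> * csqrt (- z))) holomorphic_on gauss_cut \<inter> - \<real>\<^sub>\<ge>\<^sub>0"
      by (intro holomorphic_intros hol_comp)
         (auto simp: power_mult_distrib complex_nonpos_Reals_iff complex_nonneg_Reals_iff)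
    ultimately show ?thesis by simp
  qed
  \<comment> \<open>The disc covers the branch point 0, where no root is holomorphic but the even
    series in the root is a power series in z.\<close>
  moreover have "F holomorphic_on ball 0 1"
  proof (rule power_series_holomorphic)
    fix w :: complex assume "w \<in> ball 0 1"
    thus "(\<lambda>n. pochhammer (\<kappa> / 2) n * pochhammer ((\<kappa> + 1) / 2) n * rGamma (\<alpha> + 1 / 2 + of_nat n) / fact n *
              (w - 0) ^ n) sums F w"
      using sums[of w] by (simp add: hyp2F1_reg_term_def[abs_def] mult_ac)
  qed
  ultimately have "F holomorphic_on (gauss_cut \<inter> - \<real>\<^sub>\<le>\<^sub>0) \<union> (gauss_cut \<inter> - \<real>\<^sub>\<ge>\<^sub>0) \<union> ball 0 1"
    using open_gauss_cut by (intro holomorphic_on_Un open_Un open_Int) (auto simp: open_Compl)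
  moreover have "gauss_cut \<subseteq> (gauss_cut \<inter> - \<real>\<^sub>\<le>\<^sub>0) \<union> (gauss_cut \<inter> - \<real>\<^sub>\<ge>\<^sub>0) \<union> ball 0 1"
  proof
    fix x assume "x \<in> gauss_cut"
    thus "x \<in> (gauss_cut \<inter> - \<real>\<^sub>\<le>\<^sub>0) \<union> (gauss_cut \<inter> - \<real>\<^sub>\<ge>\<^sub>0) \<union> ball 0 1"
    proof (cases "x = 0")
      case False
      with \<open>x \<in> gauss_cut\<close> show ?thesis
        by (auto simp: complex_nonpos_Reals_iff complex_nonneg_Reals_iff complex_eq_iff)
    qed simp
  qed
  ultimately show "(\<lambda>z. 4 powr \<alpha> / (2 * of_real (sqrt pi) * Gamma \<alpha>) * symmetric_euler \<kappa> \<alpha> (csqrt z))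
                     holomorphic_on gauss_cut"
    unfolding F_def C_def by (rule holomorphic_on_subset)
qed

section \<open>Powers of positive reals, and the Jacobi function on the real axis\<close>

text \<open>Writing powers of positive reals as exponentials turns identities between products of
  powers into linear identities between logarithms; most of the exponent bookkeeping below is done
  in this way.\<close>

lemma of_real_powr_exp: "x > 0 \<Longrightarrow> complex_of_real x powr s = exp (s * of_real (ln x))"
  by (simp add: powr_def Ln_of_real)

text \<open>The powers of 2 from 2 w^2 - 2 and 2 w^2 combine with 2^(\<alpha> + \<beta> + \<gamma>)
  to 1/2.\<close>

lemma jacobi_Q_real:
  fixes w :: real
  assumes "w > 1"
  shows "jacobi_Q \<gamma> \<alpha> \<beta> (2 * (of_real w)\<^sup>2 - 1) =
           Gamma (\<alpha> + \<gamma> + 1) * Gamma (\<beta> + \<gamma> + 1) / 2 *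
           of_real (w\<^sup>2 - 1) powr (- (\<alpha> + \<gamma> + 1)) * of_real (w\<^sup>2) powr (- \<beta>) *
           hyp2F1_reg (\<gamma> + 1) (\<alpha> + \<gamma> + 1) (\<alpha> + \<beta> + 2 * \<gamma> + 2) (1 / (1 - of_real (w\<^sup>2)))"
proof -
  have y: "w\<^sup>2 > 1" using assms one_less_power[of w 2] by simp
  have 1: "2 * (complex_of_real w)\<^sup>2 - 1 - 1 = of_real (2 * (w\<^sup>2 - 1))"
          "2 * (complex_of_real w)\<^sup>2 - 1 + 1 = of_real (2 * w\<^sup>2)"
          "2 / (1 - (2 * (complex_of_real w)\<^sup>2 - 1)) = 1 / (1 - of_real (w\<^sup>2))"
          "(2 :: complex) = of_real 2"
    using y by (simp_all add: divide_simps)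
  have pos: "w\<^sup>2 > 0" "w\<^sup>2 - 1 > 0" "2 * w\<^sup>2 > 0" "2 * (w\<^sup>2 - 1) > 0" "(2 :: real) > 0"
    using y by auto
  have ln: "ln (2 * (w\<^sup>2 - 1)) = ln 2 + ln (w\<^sup>2 - 1)" "ln (2 * w\<^sup>2) = ln 2 + ln (w\<^sup>2)"
    using ln_mult_pos[OF pos(5,2)] ln_mult_pos[OF pos(5,1)] by auto
  have "complex_of_real 2 = exp (of_real (ln 2))" unfolding exp_of_real by simp
  hence half: "a / 2 = a * exp (- of_real (ln 2))" for a :: complex
    by (simp add: exp_minus field_simps)
  have 2: "complex_of_real 2 powr (\<alpha> + \<beta> + \<gamma>) / (of_real (2 * (w\<^sup>2 - 1)) powr (\<alpha> + \<gamma> + 1) * of_real (2 * w\<^sup>2) powr \<beta>) =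
         of_real (w\<^sup>2 - 1) powr (- (\<alpha> + \<gamma> + 1)) * of_real (w\<^sup>2) powr (- \<beta>) / 2"
    unfolding half pos[THEN of_real_powr_exp] ln exp_add[symmetric] exp_diff[symmetric]
    by (intro arg_cong[where f = exp]) (simp only: of_real_add, simp add: algebra_simps)
  have "jacobi_Q \<gamma> \<alpha> \<beta> (2 * (of_real w)\<^sup>2 - 1) =
     complex_of_real 2 powr (\<alpha> + \<beta> + \<gamma>) / (of_real (2 * (w\<^sup>2 - 1)) powr (\<alpha> + \<gamma> + 1) * of_real (2 * w\<^sup>2) powr \<beta>) *
     (Gamma (\<alpha> + \<gamma> + 1) * Gamma (\<beta> + \<gamma> + 1)) *
     hyp2F1_reg (\<gamma> + 1) (\<alpha> + \<gamma> + 1) (\<alpha> + \<beta> + 2 * \<gamma> + 2) (1 / (1 - of_real (w\<^sup>2)))"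
    unfolding jacobi_Q_def 1(1-3) by simp
  thus ?thesis unfolding 2 by (simp only: mult_ac times_divide_eq_left times_divide_eq_right)
qed

subsection \<open>The multiplicative convolution of two beta weights\<close>

text \<open>Uniform in n because t^n \<le> 1 on the support; multiplying coefficients by these Beta
  values therefore keeps a power series absolutely convergent.\<close>

lemma norm_Beta_le:
  assumes p: "Re p > 0" and q: "Re q > 0"
  shows "norm (Beta (p + of_nat n) q) \<le> (\<integral>t. norm (beta_weight p q t) \<partial>lborel)"
proof -
  have int: "integrable lborel (beta_weight (p + of_nat n) q)"
    using p q by (intro integrable_beta_weight) auto
  have "norm (Beta (p + of_nat n) q) = norm (\<integral>t. beta_weight (p + of_nat n) q t \<partial>lborel)"
    using p q by (subst integral_beta_weight) auto
  also have "\<dots> \<le> (\<integral>t. norm (beta_weight (p + of_nat n) q t) \<partial>lborel)"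
    by (rule integral_norm_bound)
  also have "\<dots> \<le> (\<integral>t. norm (beta_weight p q t) \<partial>lborel)"
  proof (rule integral_mono)
    fix t
    have "norm (beta_weight p q t) * \<bar>t\<bar> ^ n \<le> norm (beta_weight p q t)"
    proof (cases "beta_weight p q t = 0")
      case False
      thus ?thesis by (intro mult_left_le power_le_one) (auto dest: beta_weight_nonzeroD)
    qed simp
    thus "norm (beta_weight (p + of_nat n) q t) \<le> norm (beta_weight p q t)"
      by (simp add: norm_mult norm_power flip: beta_weight_times_power)
  qed (use int integrable_beta_weight[OF p q] in auto)
  finally show ?thesis .
qed

lemma summable_norm_hyp2F1_reg_term:
  assumes "Re b > 0" "Re (c - b) > 0" "norm z < 1"
  shows "summable (\<lambda>n. norm (hyp2F1_reg_term a b c z n))"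
proof -
  define d where "d n = pochhammer a n * pochhammer b n * rGamma (c + of_nat n) / fact n" for n
  have term_eq: "hyp2F1_reg_term a b c u = (\<lambda>n. d n * u ^ n)" for u
    by (auto simp: hyp2F1_reg_term_def d_def fun_eq_iff)
  obtain r where r: "norm z < r" "r < 1" using dense assms(3) by blast
  hence "0 \<le> r" using norm_ge_zero[of z] by linarith
  hence "summable (\<lambda>n. d n * of_real r ^ n)"
    using hyp2F1_reg_sums[OF assms(1,2), of "of_real r" a] r by (auto simp: term_eq sums_iff)
  thus ?thesis
    unfolding term_eq by (rule powser_insidea) (use r \<open>0 \<le> r\<close> in auto)
qed

text \<open>
  The multiplicative convolution of two beta weights. Substituting \<open>v = t + (1 - t) q\<close> shows that it is
  the Gauss function with argument \<open>1 - t\<close> and parameters \<open>\<alpha> + p' - p\<close>, \<open>\<alpha>\<close>, \<open>2\<alpha>\<close>, written as an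
  Euler integral.
\<close>

definition beta_convolution :: "complex \<Rightarrow> complex \<Rightarrow> complex \<Rightarrow> real \<Rightarrow> complex" where
  "beta_convolution \<alpha> p p' t =
     (\<integral>v. beta_weight p \<alpha> v * \<bar>1 / v\<bar> * beta_weight p' \<alpha> (t / v) \<partial>lborel)"

lemma beta_convolution_outside: "t \<le> 0 \<or> 1 \<le> t \<Longrightarrow> beta_convolution \<alpha> p p' t = 0"
proof -
  assume t: "t \<le> 0 \<or> 1 \<le> t"
  have "(\<lambda>v. beta_weight p \<alpha> v * \<bar>1 / v\<bar> * beta_weight p' \<alpha> (t / v)) = (\<lambda>v. 0)"
    using t by (auto simp: beta_weight_def fun_eq_iff divide_less_eq zero_less_divide_iff)
  thus ?thesis unfolding beta_convolution_def by (simp only:) simp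
qed

lemma beta_convolution_eq:
  assumes t: "0 < t" "t < 1"
  shows "beta_convolution \<alpha> p p' t = of_real t powr (p' - 1) * of_real (1 - t) powr (2 * \<alpha> - 1) *
           (\<integral>q. beta_weight \<alpha> \<alpha> q * of_real (q + t * (1 - q)) powr (p - p' - \<alpha>) \<partial>lborel)"
proof -
  have "beta_convolution \<alpha> p p' t =
     (\<integral>q. of_real (1 - t) *
        (beta_weight p \<alpha> (t + (1 - t) * q) * \<bar>1 / (t + (1 - t) * q)\<bar> * beta_weight p' \<alpha> (t / (t + (1 - t) * q))) \<partial>lborel)"
    unfolding beta_convolution_def integral_mult_right_zero using t
    by (subst lborel_integral_real_affine[of "1 - t" _ t]) (auto simp: scaleR_conv_of_real)
  also have "\<dots> = (\<integral>q. (of_real t powr (p' - 1) * of_real (1 - t) powr (2 * \<alpha> - 1)) *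
           (beta_weight \<alpha> \<alpha> q * of_real (q + t * (1 - q)) powr (p - p' - \<alpha>)) \<partial>lborel)"
  proof (rule Bochner_Integration.integral_cong)
    fix q :: real
    define v where "v = t + (1 - t) * q"
    \<comment> \<open>With 1 - v and v - t factored, the powers of 1 - t separate; v is left with
      the exponent (p - 1) - 1 - (p' - 1) - (\<alpha> - 1) = p - p' - \<alpha>.\<close>
    have v': "v = q + t * (1 - q)" "1 - v = (1 - t) * (1 - q)" "v - t = (1 - t) * q"
      by (simp_all add: v_def algebra_simps)
    show "of_real (1 - t) *
        (beta_weight p \<alpha> (t + (1 - t) * q) * \<bar>1 / (t + (1 - t) * q)\<bar> * beta_weight p' \<alpha> (t / (t + (1 - t) * q))) =
        (of_real t powr (p' - 1) * of_real (1 - t) powr (2 * \<alpha> - 1)) *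
           (beta_weight \<alpha> \<alpha> q * of_real (q + t * (1 - q)) powr (p - p' - \<alpha>))"
      unfolding v'(1)[symmetric] v_def[symmetric]
    proof (cases "0 < q \<and> q < 1")
      case True
      have pos: "0 < t" "0 < 1 - t" "0 < q" "0 < 1 - q" "0 < v" "0 < 1 - v" "0 < v - t"
        unfolding v'(2,3) using t True by (auto simp: v'(1) add_pos_pos)
      have tv: "0 < t / v" "t / v < 1" "0 < 1 - t / v" using pos by auto
      have ln: "ln (1 - v) = ln (1 - t) + ln (1 - q)" "ln (t / v) = ln t - ln v"
               "ln (1 - t / v) = ln (1 - t) + ln q - ln v"
      proof -
        show "ln (1 - v) = ln (1 - t) + ln (1 - q)" unfolding v'(2) using pos by (simp add: ln_mult_pos)
        show "ln (t / v) = ln t - ln v" using pos by (simp add: ln_div)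
        have "1 - t / v = (v - t) / v" using pos by (simp add: field_simps)
        hence "1 - t / v = (1 - t) * q / v" by (simp only: v'(3))
        thus "ln (1 - t / v) = ln (1 - t) + ln q - ln v" using pos by (simp add: ln_div ln_mult_pos)
      qed
      have ex: "of_real (1 - t) = exp (complex_of_real (ln (1 - t)))"
               "of_real \<bar>1 / v\<bar> = exp (- complex_of_real (ln v))"
        using pos by (auto simp: exp_minus exp_of_real inverse_eq_divide)
      have bw: "beta_weight p \<alpha> v = of_real v powr (p - 1) * of_real (1 - v) powr (\<alpha> - 1)"
               "beta_weight p' \<alpha> (t / v) = of_real (t / v) powr (p' - 1) * of_real (1 - t / v) powr (\<alpha> - 1)"
               "beta_weight \<alpha> \<alpha> q = of_real q powr (\<alpha> - 1) * of_real (1 - q) powr (\<alpha> - 1)"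
        using pos tv unfolding beta_weight_def by auto
      show "of_real (1 - t) * (beta_weight p \<alpha> v * of_real \<bar>1 / v\<bar> * beta_weight p' \<alpha> (t / v)) =
        (of_real t powr (p' - 1) * of_real (1 - t) powr (2 * \<alpha> - 1)) *
           (beta_weight \<alpha> \<alpha> q * of_real v powr (p - p' - \<alpha>))"
        unfolding bw pos[THEN of_real_powr_exp] tv(1,3)[THEN of_real_powr_exp]
        unfolding ex exp_add[symmetric] ln
        by (intro arg_cong[where f = exp]) (simp only: of_real_add of_real_diff, simp add: algebra_simps)
    next
      case False
      \<comment> \<open>For q outside (0, 1) either 1 - v or v - t is not positive, so one of the
        weights vanishes.\<close>
      have "beta_weight p \<alpha> v * beta_weight p' \<alpha> (t / v) = 0"
      proof (rule ccontr)
        assume "beta_weight p \<alpha> v * beta_weight p' \<alpha> (t / v) \<noteq> 0"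
        hence "0 < v" "v < 1" "t / v < 1" by (auto dest: beta_weight_nonzeroD)
        hence "0 < 1 - v" "0 < v - t" by (auto simp: field_simps)
        thus False using False t unfolding v'(2,3) by (auto simp: zero_less_mult_iff)
      qed
      moreover have "beta_weight \<alpha> \<alpha> q = 0" using False by (auto simp: beta_weight_def)
      ultimately show "of_real (1 - t) * (beta_weight p \<alpha> v * of_real \<bar>1 / v\<bar> * beta_weight p' \<alpha> (t / v)) =
        (of_real t powr (p' - 1) * of_real (1 - t) powr (2 * \<alpha> - 1)) *
           (beta_weight \<alpha> \<alpha> q * of_real v powr (p - p' - \<alpha>))" by auto
    qed
  qed simp
  finally show ?thesis by simp
qed

text \<open>Fubini puts t = u v, so the u-integral contributes B(p' + n, \<alpha>) to the n-th term
  and the v-integral B(p + n, \<alpha>). The integrand is written with the series and not with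
  \<open>hyp2F1_reg\<close>: a series of Borel functions is Borel on the whole line, whatever its
  value outside the disc of convergence.\<close>

lemma
  assumes \<alpha>: "Re \<alpha> > 0" and p: "Re p > 0" and p': "Re p' > 0" and r: "\<bar>r\<bar> < (1 :: real)"
  defines "c \<equiv> \<alpha> + p + p'"
  defines "T \<equiv> (\<lambda>t. beta_convolution \<alpha> p p' t * (\<Sum>n. hyp2F1_reg_term (\<alpha> + p) (\<alpha> + p') c (of_real (r * t)) n))"
  shows integrable_beta_convolution_hyp2F1_reg: "integrable lborel T"
    and integral_beta_convolution_hyp2F1_reg:
      "integral\<^sup>L lborel T = (Gamma \<alpha>)\<^sup>2 * Gamma p * Gamma p' / (Gamma (\<alpha> + p) * Gamma (\<alpha> + p')) *
         hyp2F1_reg p p' c (of_real r)"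
proof -
  define d where "d n = pochhammer (\<alpha> + p) n * pochhammer (\<alpha> + p') n * rGamma (c + of_nat n) / fact n" for n
  have term_eq: "hyp2F1_reg_term (\<alpha> + p) (\<alpha> + p') c u = (\<lambda>n. d n * u ^ n)" for u
    by (auto simp: hyp2F1_reg_term_def d_def fun_eq_iff)
  define g where "g t = (\<Sum>n. d n * of_real (r * t) ^ n)" for t
  have summ: "summable (\<lambda>n. norm (d n * u ^ n))" if "norm u < 1" for u
  proof -
    have "summable (\<lambda>n. norm (hyp2F1_reg_term (\<alpha> + p) (\<alpha> + p') c u n))"
      by (rule summable_norm_hyp2F1_reg_term) (use \<alpha> p p' that in \<open>auto simp: c_def\<close>)
    thus ?thesis unfolding term_eq .
  qed
  have [measurable]: "g \<in> borel_measurable borel" unfolding g_def by measurable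
  \<comment> \<open>The convolution lemma needs a bound at the products u v of points in (0, 1); the
    absolute sum at r serves.\<close>
  have g_bound: "norm (g t) \<le> (\<Sum>n. norm (d n * of_real r ^ n))" if "\<bar>t\<bar> \<le> 1" for t
  proof -
    have le: "norm (d n * of_real (r * t) ^ n) \<le> norm (d n * of_real r ^ n)" for n
    proof -
      have "\<bar>t\<bar> ^ n \<le> 1" using that by (simp add: power_le_one)
      from mult_left_mono[OF this, of "norm (d n) * \<bar>r\<bar> ^ n"] show ?thesis
        by (simp add: norm_mult norm_power power_mult_distrib abs_mult mult_ac)
    qed
    have s: "summable (\<lambda>n. norm (d n * of_real r ^ n))" using summ[of "of_real r"] r by simp
    show ?thesis unfolding g_def
      by (intro order.trans[OF summable_norm] suminf_le le s summable_comparison_test'[OF s])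
         (use le in auto)
  qed
  have T_eq: "T = (\<lambda>t. (\<integral>v. beta_weight p \<alpha> v * of_real \<bar>1 / v\<bar> * beta_weight p' \<alpha> (0 + 1 / v * t) \<partial>lborel) * g t)"
    unfolding T_def beta_convolution_def g_def term_eq by simp
  note intw = integrable_beta_weight[OF p \<alpha>] integrable_beta_weight[OF p' \<alpha>]
  have bd: "norm (g ((u - 0) / (1 / v))) \<le> (\<Sum>n. norm (d n * of_real r ^ n))"
    if "beta_weight p \<alpha> v \<noteq> 0" "beta_weight p' \<alpha> u \<noteq> 0" for u v
    using that by (intro g_bound) (auto dest!: beta_weight_nonzeroD simp: abs_mult intro!: mult_le_one)
  show "integrable lborel T"
    unfolding T_eq
    by (rule integrable_affine_convolution[where l = "\<lambda>_. 0" and m = "\<lambda>v. 1 / v" and g = g, OF intw _ _ _ _ bd])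
       (auto dest: beta_weight_nonzeroD)
  have "integral\<^sup>L lborel T = (\<integral>v. beta_weight p \<alpha> v * (\<integral>u. beta_weight p' \<alpha> u * g ((u - 0) / (1 / v)) \<partial>lborel) \<partial>lborel)"
    unfolding T_eq
    by (rule integral_affine_convolution[where l = "\<lambda>_. 0" and m = "\<lambda>v. 1 / v" and g = g, OF intw _ _ _ _ bd])
       (auto dest: beta_weight_nonzeroD)
  also have "\<dots> = (\<integral>v. beta_weight p \<alpha> v * (\<Sum>n. (d n * Beta (p' + of_nat n) \<alpha>) * (of_real r * of_real v) ^ n) \<partial>lborel)"
  proof (rule Bochner_Integration.integral_cong)
    fix v
    show "beta_weight p \<alpha> v * (\<integral>u. beta_weight p' \<alpha> u * g ((u - 0) / (1 / v)) \<partial>lborel) =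
          beta_weight p \<alpha> v * (\<Sum>n. (d n * Beta (p' + of_nat n) \<alpha>) * (of_real r * of_real v) ^ n)"
    proof (cases "beta_weight p \<alpha> v = 0")
      case False
      hence "\<bar>v\<bar> \<le> 1" by (auto dest!: beta_weight_nonzeroD)
      hence "norm (complex_of_real (r * v)) < 1"
        using r mult_left_le[of "\<bar>v\<bar>" "\<bar>r\<bar>"] by (simp add: abs_mult norm_mult)
      from sums_unique[OF beta_weight_powser[OF p' \<alpha> summ[OF this]]]
      show ?thesis by (simp add: g_def mult_ac)
    qed simp
  qed simp
  also have "(\<lambda>n. (d n * Beta (p' + of_nat n) \<alpha>) * of_real r ^ n * Beta (p + of_nat n) \<alpha>) sums \<dots>"
  proof (rule beta_weight_powser[OF p \<alpha>])
    show "summable (\<lambda>n. norm (d n * Beta (p' + of_nat n) \<alpha> * of_real r ^ n))"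
    proof (rule summable_comparison_test')
      show "summable (\<lambda>n. norm (d n * of_real r ^ n) * (\<integral>t. norm (beta_weight p' \<alpha> t) \<partial>lborel))"
        using summ[of "of_real r"] r by (intro summable_mult2) simp
      show "norm (norm (d n * Beta (p' + of_nat n) \<alpha> * of_real r ^ n)) \<le>
              norm (d n * of_real r ^ n) * (\<integral>t. norm (beta_weight p' \<alpha> t) \<partial>lborel)" for n
        using mult_left_mono[OF norm_Beta_le[OF p' \<alpha>, of n], of "norm (d n * of_real r ^ n)"]
        by (simp add: norm_mult mult_ac)
    qed
  qed
  finally have sums1: "(\<lambda>n. (d n * Beta (p' + of_nat n) \<alpha>) * of_real r ^ n * Beta (p + of_nat n) \<alpha>) sums integral\<^sup>L lborel T" .
  define K where "K = (Gamma \<alpha>)\<^sup>2 * Gamma p * Gamma p' / (Gamma (\<alpha> + p) * Gamma (\<alpha> + p'))"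
  have "(\<lambda>n. K * hyp2F1_reg_term p p' c (of_real r) n) sums (K * hyp2F1_reg p p' c (of_real r))"
    by (intro sums_mult hyp2F1_reg_sums) (use p p' \<alpha> r in \<open>auto simp: c_def\<close>)
  also have "(\<lambda>n. K * hyp2F1_reg_term p p' c (of_real r) n) =
             (\<lambda>n. (d n * Beta (p' + of_nat n) \<alpha>) * of_real r ^ n * Beta (p + of_nat n) \<alpha>)"
  proof
    fix n
    have A: "Re (\<alpha> + p) > 0" "Re (\<alpha> + p') > 0" using \<alpha> p p' by auto
    have nz: "Gamma (\<alpha> + p) \<noteq> 0" "Gamma (\<alpha> + p') \<noteq> 0"
      using A by (intro Gamma_nonzero_if_Re_pos; simp)+
    have "Gamma (\<alpha> + p + of_nat n) \<noteq> 0" "Gamma (\<alpha> + p' + of_nat n) \<noteq> 0"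
      using A by (intro Gamma_nonzero_if_Re_pos; simp)+
    hence poch: "pochhammer (\<alpha> + p) n \<noteq> 0" "pochhammer (\<alpha> + p') n \<noteq> 0"
      using A by (auto simp: Gamma_plus_of_nat)
    have "p + of_nat n + \<alpha> = \<alpha> + p + of_nat n" "p' + of_nat n + \<alpha> = \<alpha> + p' + of_nat n" by auto
    \<comment> \<open>That is, B(p + n, \<alpha>) = B(p, \<alpha>) (p)_n / (\<alpha> + p)_n, which
      exchanges the numerator parameters.\<close>
    hence B: "Beta (p + of_nat n) \<alpha> = pochhammer p n * Gamma p * Gamma \<alpha> / (pochhammer (\<alpha> + p) n * Gamma (\<alpha> + p))"
             "Beta (p' + of_nat n) \<alpha> = pochhammer p' n * Gamma p' * Gamma \<alpha> / (pochhammer (\<alpha> + p') n * Gamma (\<alpha> + p'))"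
      using p p' A by (simp_all only: Beta_def Gamma_plus_of_nat)
    show "K * hyp2F1_reg_term p p' c (of_real r) n =
          (d n * Beta (p' + of_nat n) \<alpha>) * of_real r ^ n * Beta (p + of_nat n) \<alpha>"
      unfolding B K_def d_def hyp2F1_reg_term_def using nz poch
      by (simp add: power2_eq_square mult_ac)
  qed
  finally show "integral\<^sup>L lborel T = K * hyp2F1_reg p p' c (of_real r)"
    using sums1 by (rule sums_unique2[rotated])
qed

subsection \<open>The Jacobi function and the kernels on the real axis\<close>

text \<open>Pfaff with \<open>b = \<alpha> + \<gamma> + 1\<close>: its factor (w^2 / (w^2 -
  1))^(-(\<gamma> + 1)) brings the exponent of w^2 - 1 to -\<alpha>, as in front of the integral
  formula. This form describes the left-hand side at w = x.\<close>

lemma jacobi_Q_Pfaff1: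
  fixes w :: real
  assumes w: "w > 1" and "Re (\<alpha> + \<gamma> + 1) > 0" "Re (\<beta> + \<gamma> + 1) > 0"
  shows "jacobi_Q \<gamma> \<alpha> \<beta> (2 * (of_real w)\<^sup>2 - 1) =
           Gamma (\<alpha> + (\<gamma> + 1)) * Gamma (\<beta> + \<gamma> + 1) / 2 *
           of_real (w\<^sup>2 - 1) powr (- \<alpha>) * of_real w powr (- 2 * (\<beta> + \<gamma> + 1)) *
           hyp2F1_reg (\<gamma> + 1) (\<beta> + \<gamma> + 1) (\<alpha> + (\<gamma> + 1) + (\<beta> + \<gamma> + 1)) (of_real (1 / w\<^sup>2))"
proof -
  have y: "w\<^sup>2 > 1" using w one_less_power[of w 2] by simp
  have pos: "w\<^sup>2 > 0" "w\<^sup>2 - 1 > 0" "w > 0" "w\<^sup>2 / (w\<^sup>2 - 1) > 0" using y w by auto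
  have c: "\<alpha> + \<beta> + 2 * \<gamma> + 2 - (\<alpha> + \<gamma> + 1) = \<beta> + \<gamma> + 1"
          "\<alpha> + \<beta> + 2 * \<gamma> + 2 = \<alpha> + (\<gamma> + 1) + (\<beta> + \<gamma> + 1)" "\<alpha> + \<gamma> + 1 = \<alpha> + (\<gamma> + 1)"
    by (simp_all add: algebra_simps)
  have pf: "hyp2F1_reg (\<gamma> + 1) (\<alpha> + \<gamma> + 1) (\<alpha> + \<beta> + 2 * \<gamma> + 2) (1 / (1 - of_real (w\<^sup>2))) =
        of_real (w\<^sup>2 / (w\<^sup>2 - 1)) powr (- (\<gamma> + 1)) *
        hyp2F1_reg (\<gamma> + 1) (\<beta> + \<gamma> + 1) (\<alpha> + \<beta> + 2 * \<gamma> + 2) (1 / of_real (w\<^sup>2))"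
    using hyp2F1_reg_Pfaff[of "\<alpha> + \<gamma> + 1" "\<alpha> + \<beta> + 2 * \<gamma> + 2" "w\<^sup>2" "\<gamma> + 1"] assms(2,3) y
    unfolding c(1) by blast
  have ln: "ln (w\<^sup>2 / (w\<^sup>2 - 1)) = 2 * ln w - ln (w\<^sup>2 - 1)" "ln (w\<^sup>2) = 2 * ln w"
    using pos by (simp_all add: ln_div ln_realpow)
  have "of_real (w\<^sup>2 - 1) powr (- (\<alpha> + \<gamma> + 1)) * of_real (w\<^sup>2) powr (- \<beta>) *
          of_real (w\<^sup>2 / (w\<^sup>2 - 1)) powr (- (\<gamma> + 1)) =
        complex_of_real (w\<^sup>2 - 1) powr (- \<alpha>) * of_real w powr (- 2 * (\<beta> + \<gamma> + 1))"
    unfolding pos[THEN of_real_powr_exp]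
    unfolding exp_add[symmetric] ln
    by (intro arg_cong[where f = exp]) (simp only: of_real_diff of_real_mult, simp add: algebra_simps)
  hence pw: "of_real (w\<^sup>2 - 1) powr (- (\<alpha> + \<gamma> + 1)) * of_real (w\<^sup>2) powr (- \<beta>) *
          (of_real (w\<^sup>2 / (w\<^sup>2 - 1)) powr (- (\<gamma> + 1)) * h) =
        complex_of_real (w\<^sup>2 - 1) powr (- \<alpha>) * of_real w powr (- 2 * (\<beta> + \<gamma> + 1)) * h" for h
    by (simp only: mult.assoc[symmetric])
  show ?thesis
    unfolding jacobi_Q_real[OF w] pf
    by (subst mult.assoc, subst mult.assoc, subst mult.assoc[symmetric, of _ "_ powr _"], subst pw)
       (simp only: c mult.assoc of_real_divide of_real_1)
qed

text \<open>Pfaff after exchanging the numerator parameters, with \<open>b = \<gamma> + 1\<close>: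
  the powers of w^2 - 1 cancel, and under the integral only a power of w times a series in 1 / w^2
  is left.\<close>

lemma jacobi_Q_Pfaff2:
  fixes w :: real
  assumes w: "w > 1" and "Re (\<gamma> + 1) > 0" "Re (\<alpha> + \<beta> + \<gamma> + 1) > 0"
  shows "jacobi_Q \<gamma> \<alpha> \<beta> (2 * (of_real w)\<^sup>2 - 1) =
           Gamma (\<alpha> + (\<gamma> + 1)) * Gamma (\<beta> + \<gamma> + 1) / 2 * of_real w powr (- 2 * (\<alpha> + \<beta> + \<gamma> + 1)) *
           hyp2F1_reg (\<alpha> + (\<gamma> + 1)) (\<alpha> + (\<beta> + \<gamma> + 1)) (\<alpha> + (\<gamma> + 1) + (\<beta> + \<gamma> + 1)) (of_real (1 / w\<^sup>2))"
proof -
  have y: "w\<^sup>2 > 1" using w one_less_power[of w 2] by simp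
  have pos: "w\<^sup>2 > 0" "w\<^sup>2 - 1 > 0" "w > 0" "w\<^sup>2 / (w\<^sup>2 - 1) > 0" using y w by auto
  have c: "\<alpha> + \<beta> + 2 * \<gamma> + 2 - (\<gamma> + 1) = \<alpha> + \<beta> + \<gamma> + 1"
          "\<alpha> + \<beta> + 2 * \<gamma> + 2 = \<alpha> + (\<gamma> + 1) + (\<beta> + \<gamma> + 1)" "\<alpha> + \<gamma> + 1 = \<alpha> + (\<gamma> + 1)"
          "\<alpha> + (\<beta> + \<gamma> + 1) = \<alpha> + \<beta> + \<gamma> + 1"
    by (simp_all add: algebra_simps)
  have pf: "hyp2F1_reg (\<gamma> + 1) (\<alpha> + \<gamma> + 1) (\<alpha> + \<beta> + 2 * \<gamma> + 2) (1 / (1 - of_real (w\<^sup>2))) =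
        of_real (w\<^sup>2 / (w\<^sup>2 - 1)) powr (- (\<alpha> + \<gamma> + 1)) *
        hyp2F1_reg (\<alpha> + \<gamma> + 1) (\<alpha> + \<beta> + \<gamma> + 1) (\<alpha> + \<beta> + 2 * \<gamma> + 2) (1 / of_real (w\<^sup>2))"
    using hyp2F1_reg_Pfaff[of "\<gamma> + 1" "\<alpha> + \<beta> + 2 * \<gamma> + 2" "w\<^sup>2" "\<alpha> + \<gamma> + 1"] assms(2,3) y
    unfolding c(1) by (simp only: hyp2F1_reg_commute[of "\<gamma> + 1" "\<alpha> + \<gamma> + 1"])
  have ln: "ln (w\<^sup>2 / (w\<^sup>2 - 1)) = 2 * ln w - ln (w\<^sup>2 - 1)" "ln (w\<^sup>2) = 2 * ln w"
    using pos by (simp_all add: ln_div ln_realpow)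
  have "of_real (w\<^sup>2 - 1) powr (- (\<alpha> + \<gamma> + 1)) * of_real (w\<^sup>2) powr (- \<beta>) *
          of_real (w\<^sup>2 / (w\<^sup>2 - 1)) powr (- (\<alpha> + \<gamma> + 1)) =
        complex_of_real w powr (- 2 * (\<alpha> + \<beta> + \<gamma> + 1))"
    unfolding pos[THEN of_real_powr_exp]
    unfolding exp_add[symmetric] ln
    by (intro arg_cong[where f = exp]) (simp only: of_real_diff of_real_mult, simp add: algebra_simps)
  hence pw: "of_real (w\<^sup>2 - 1) powr (- (\<alpha> + \<gamma> + 1)) * of_real (w\<^sup>2) powr (- \<beta>) *
          (of_real (w\<^sup>2 / (w\<^sup>2 - 1)) powr (- (\<alpha> + \<gamma> + 1)) * h) =
        complex_of_real w powr (- 2 * (\<alpha> + \<beta> + \<gamma> + 1)) * h" for h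
    by (simp only: mult.assoc[symmetric])
  show ?thesis
    unfolding jacobi_Q_real[OF w] pf
    by (subst mult.assoc, subst mult.assoc, subst mult.assoc[symmetric, of _ "_ powr _"], subst pw)
       (simp only: c mult.assoc of_real_divide of_real_1)
qed

text \<open>What the two integrands share up to constants. The first two fractions are sqrt (E^2 -
  1) and E; \<open>symmetric_euler\<close>, at their quotient, stands for the Gauss function of the
  kernel.\<close>

definition core_integrand :: "complex \<Rightarrow> complex \<Rightarrow> complex \<Rightarrow> real \<Rightarrow> real \<Rightarrow> complex" where
  "core_integrand \<alpha> \<beta> \<gamma> x w =
     jacobi_Q \<gamma> \<alpha> \<beta> (2 * (of_real w)\<^sup>2 - 1) * of_real w powr (\<alpha> + \<beta>) *
     (of_real ((w\<^sup>2 - x\<^sup>2) / (2 * w * x)) powr (2 * \<alpha> - 1) *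
      of_real ((w\<^sup>2 + x\<^sup>2) / (2 * w * x)) powr (- (\<alpha> + \<beta>)) *
      symmetric_euler (\<alpha> + \<beta>) \<alpha> (of_real ((w\<^sup>2 - x\<^sup>2) / (w\<^sup>2 + x\<^sup>2))))"

text \<open>With w = x exp \<theta>, e and d are cosh \<theta> and sinh \<theta>, so the kernel is
  evaluated at coth \<theta>, and d / e = tanh \<theta> lies in (0, 1).\<close>

lemma kernel_arguments:
  fixes x w :: real
  assumes "0 < x" "x < w"
  defines "d \<equiv> (w\<^sup>2 - x\<^sup>2) / (2 * w * x)" and "e \<equiv> (w\<^sup>2 + x\<^sup>2) / (2 * w * x)"
  shows "0 < d" "d < e" "E (of_real x) (of_real w) = of_real e"
    and "(E (of_real x) (of_real w))\<^sup>2 - 1 = of_real (d\<^sup>2)"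
    and "E (of_real x) (of_real w) / csqrt ((E (of_real x) (of_real w))\<^sup>2 - 1) = of_real (e / d)"
    and "d / e = (w\<^sup>2 - x\<^sup>2) / (w\<^sup>2 + x\<^sup>2)" and "e\<^sup>2 = d\<^sup>2 + 1"
proof -
  have "x\<^sup>2 < w\<^sup>2" using assms by (intro power_strict_mono) auto
  thus d: "0 < d" "d < e" unfolding d_def e_def using assms by (auto intro!: divide_strict_right_mono)
  show e: "E (of_real x) (of_real w) = of_real e" unfolding E_def e_def by (simp add: add.commute)
  have "e\<^sup>2 - d\<^sup>2 = ((w\<^sup>2 + x\<^sup>2)\<^sup>2 - (w\<^sup>2 - x\<^sup>2)\<^sup>2) / (2 * w * x)\<^sup>2"
    unfolding d_def e_def power_divide by (simp add: diff_divide_distrib)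
  also have "(w\<^sup>2 + x\<^sup>2)\<^sup>2 - (w\<^sup>2 - x\<^sup>2)\<^sup>2 = (2 * w * x)\<^sup>2" by algebra
  finally show *: "e\<^sup>2 = d\<^sup>2 + 1" using assms by simp
  show **: "(E (of_real x) (of_real w))\<^sup>2 - 1 = of_real (d\<^sup>2)"
    unfolding e using * by (simp flip: of_real_power)
  have "csqrt (of_real (d\<^sup>2)) = of_real d" using d by simp
  thus "E (of_real x) (of_real w) / csqrt ((E (of_real x) (of_real w))\<^sup>2 - 1) = of_real (e / d)"
    unfolding ** unfolding e by simp
  show "d / e = (w\<^sup>2 - x\<^sup>2) / (w\<^sup>2 + x\<^sup>2)" using assms unfolding d_def e_def by simp
qed

lemma hyp2F1_reg_kernel:
  fixes d e :: real
  assumes "Re \<alpha> > 0" "0 < d" "d < e"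
  shows "hyp2F1_reg (\<kappa> / 2) ((\<kappa> + 1) / 2) (\<alpha> + 1 / 2) (1 / (of_real (e / d))\<^sup>2) =
           4 powr \<alpha> / (2 * of_real (sqrt pi) * Gamma \<alpha>) * symmetric_euler \<kappa> \<alpha> (of_real (d / e))"
proof -
  have "0 < d / e" "d / e < 1" using assms by auto
  hence "(d / e)\<^sup>2 < 1" by (simp add: power_less_one_iff)
  hence "complex_of_real ((d / e)\<^sup>2) \<in> gauss_cut" unfolding of_real_image_Ici by simp
  moreover have "csqrt (of_real (y\<^sup>2)) = of_real y" if "0 < y" for y :: real using that by simp
  from this[OF \<open>0 < d / e\<close>] have "csqrt (of_real ((d / e)\<^sup>2)) = of_real (d / e)" .
  moreover have "1 / (complex_of_real (e / d))\<^sup>2 = of_real ((d / e)\<^sup>2)" by (simp add: power_divide)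
  ultimately show ?thesis using hyp2F1_reg_quadratic[OF assms(1), of "of_real ((d / e)\<^sup>2)" \<kappa>]
    by (simp only:)
qed

lemma legendre_integrand_eq:
  fixes x w :: real
  assumes \<alpha>: "Re \<alpha> > 0" and xw: "0 < x" "x < w"
  shows "legendre_integrand \<alpha> \<beta> \<gamma> (of_real x) (of_real w) =
           of_real (sqrt pi) * exp (\<i> * of_real pi * \<beta>) * Gamma (\<alpha> + \<beta>) / 2 powr \<alpha> *
           (4 powr \<alpha> / (2 * of_real (sqrt pi) * Gamma \<alpha>)) * core_integrand \<alpha> \<beta> \<gamma> x w"
proof -
  define d e where "d = (w\<^sup>2 - x\<^sup>2) / (2 * w * x)" and "e = (w\<^sup>2 + x\<^sup>2) / (2 * w * x)"
  note * = kernel_arguments[OF xw, folded d_def e_def]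
  have pos: "0 < e" "0 < d" "0 < e - d" "0 < e + d" "0 < e / d" "0 < e / d - 1" "0 < e / d + 1" "0 < d\<^sup>2"
    using *(1,2) by (auto simp: add_pos_pos)
  have ln: "ln (e / d) = ln e - ln d" "ln (d\<^sup>2) = 2 * ln d" "ln (e / d + 1) = - 2 * ln d - ln (e / d - 1)"
  proof -
    show "ln (e / d) = ln e - ln d" "ln (d\<^sup>2) = 2 * ln d" using pos by (simp_all add: ln_div ln_realpow)
    \<comment> \<open>By e^2 - d^2 = 1 the bases of the two Legendre factors multiply to d^(-2);
      together the factors contribute d^(-\<beta>).\<close>
    have "(e / d + 1) * (e / d - 1) = (e\<^sup>2 - d\<^sup>2) / d\<^sup>2"
      using pos by (simp add: field_simps power2_eq_square)
    also have "\<dots> = 1 / d\<^sup>2" using *(7) by simp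
    finally have "ln (e / d + 1) + ln (e / d - 1) = ln (1 / d\<^sup>2)"
      using pos by (simp flip: ln_mult_pos)
    thus "ln (e / d + 1) = - 2 * ln d - ln (e / d - 1)" using pos by (simp add: ln_div ln_realpow)
  qed
  have "of_real (d\<^sup>2) powr ((\<alpha> - 1) / 2) * (of_real (e / d - 1) powr (\<beta> / 2) * of_real (e / d + 1) powr (\<beta> / 2)) /
          of_real (e / d) powr (\<alpha> + \<beta>) =
        complex_of_real d powr (2 * \<alpha> - 1) * of_real e powr (- (\<alpha> + \<beta>))"
    unfolding pos[THEN of_real_powr_exp]
    unfolding exp_add[symmetric] exp_diff[symmetric] ln
    by (intro arg_cong[where f = exp])
       (simp only: of_real_diff of_real_mult of_real_minus, simp add: field_simps)
  hence pw: "complex_of_real d powr (2 * \<alpha> - 1) * of_real e powr (- (\<alpha> + \<beta>)) =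
        of_real (d\<^sup>2) powr ((\<alpha> - 1) / 2) * (of_real (e / d - 1) powr (\<beta> / 2) * of_real (e / d + 1) powr (\<beta> / 2)) /
          of_real (e / d) powr (\<alpha> + \<beta>)" ..
  have c: "\<alpha> - 1 + \<beta> + 1 = \<alpha> + \<beta>" "\<alpha> - 1 + \<beta> + 2 = \<alpha> + \<beta> + 1" "\<alpha> - 1 + 3 / 2 = \<alpha> + 1 / 2" "\<alpha> - 1 + 1 = \<alpha>"
          "complex_of_real (e / d) - 1 = of_real (e / d - 1)" "complex_of_real (e / d) + 1 = of_real (e / d + 1)"
    by (simp_all add: algebra_simps)
  show ?thesis
    unfolding legendre_integrand_def *(5)
    unfolding core_integrand_def d_def[symmetric] e_def[symmetric] *(6)[symmetric]
      *(4) legendre_Q_def c hyp2F1_reg_kernel[OF \<alpha> *(1,2)] pw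
    by (simp only: times_divide_eq_left times_divide_eq_right divide_divide_eq_left mult_ac)
qed

lemma gegenbauer_integrand_eq:
  fixes x w :: real
  assumes \<alpha>: "Re \<alpha> > 0" and xw: "0 < x" "x < w"
  shows "gegenbauer_integrand \<alpha> \<beta> \<gamma> (of_real x) (of_real w) =
           exp (\<i> * of_real pi * (\<beta> + 1 / 2)) * Gamma (\<alpha> + \<beta>) / (Gamma (\<beta> + 1 / 2) * 2 powr (\<alpha> + \<beta>)) *
           (4 powr \<alpha> / (2 * of_real (sqrt pi) * Gamma \<alpha>)) * core_integrand \<alpha> \<beta> \<gamma> x w"
proof -
  define d e where "d = (w\<^sup>2 - x\<^sup>2) / (2 * w * x)" and "e = (w\<^sup>2 + x\<^sup>2) / (2 * w * x)"
  note * = kernel_arguments[OF xw, folded d_def e_def]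
  have pos: "0 < e" "0 < d" "0 < e / d" "0 < d\<^sup>2" using *(1,2) by auto
  have ln: "ln (e / d) = ln e - ln d" "ln (d\<^sup>2) = 2 * ln d"
    using pos by (simp_all add: ln_div ln_realpow)
  \<comment> \<open>The kernel power d^(\<alpha> - \<beta> - 1) already contains the d^(-\<beta>)
    that the Legendre case takes from its two extra factors, so the same powers of d and e
    result.\<close>
  have "of_real (d\<^sup>2) powr ((\<alpha> - \<beta> - 1) / 2) / of_real (e / d) powr (\<alpha> + \<beta>) =
        complex_of_real d powr (2 * \<alpha> - 1) * of_real e powr (- (\<alpha> + \<beta>))"
    unfolding pos[THEN of_real_powr_exp]
    unfolding exp_add[symmetric] exp_diff[symmetric] ln
    by (intro arg_cong[where f = exp])
       (simp only: of_real_diff of_real_mult of_real_minus, simp add: field_simps)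
  hence pw: "complex_of_real d powr (2 * \<alpha> - 1) * of_real e powr (- (\<alpha> + \<beta>)) =
        of_real (d\<^sup>2) powr ((\<alpha> - \<beta> - 1) / 2) / of_real (e / d) powr (\<alpha> + \<beta>)" ..
  have c: "\<alpha> - \<beta> - 1 + 2 * (\<beta> + 1 / 2) = \<alpha> + \<beta>" "(\<alpha> - \<beta> - 1) / 2 + (\<beta> + 1 / 2) = (\<alpha> + \<beta>) / 2"
          "(\<alpha> + \<beta>) / 2 + 1 / 2 = (\<alpha> + \<beta> + 1) / 2" "\<alpha> - \<beta> - 1 + (\<beta> + 1 / 2) + 1 = \<alpha> + 1 / 2"
    by (simp_all add: field_simps)
  have two: "(2 * complex_of_real (e / d)) powr (\<alpha> + \<beta>) = 2 powr (\<alpha> + \<beta>) * of_real (e / d) powr (\<alpha> + \<beta>)"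
    using pos by (intro powr_times_real) auto
  show ?thesis
    unfolding gegenbauer_integrand_def *(5)
    unfolding core_integrand_def d_def[symmetric] e_def[symmetric] *(6)[symmetric]
      *(4) gegenbauer_D_def c hyp2F1_reg_kernel[OF \<alpha> *(1,2)] pw two
    by (simp only: times_divide_eq_left times_divide_eq_right divide_divide_eq_left mult_ac)
qed

subsection \<open>The integral formula\<close>

text \<open>With t = x^2 / w^2 the integrand of \<open>symmetric_euler\<close> becomes that of
  \<open>beta_convolution_eq\<close> for p = \<gamma> + 1, p' = \<beta> + \<gamma> + 1, where p - p'
  - \<alpha> = - (\<alpha> + \<beta>). The modulus on the right is the Jacobian of t as a function
  of w.\<close>

lemma core_integrand_eq:
  fixes x w :: real
  assumes \<alpha>: "Re \<alpha> > 0" and \<gamma>: "Re \<gamma> > -1" and \<beta>\<gamma>: "Re (\<gamma> + \<beta>) > -1" and x: "1 < x" and xw: "x < w"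
  defines "T \<equiv> (\<lambda>t. beta_convolution \<alpha> (\<gamma> + 1) (\<beta> + \<gamma> + 1) t *
     (\<Sum>n. hyp2F1_reg_term (\<alpha> + (\<gamma> + 1)) (\<alpha> + (\<beta> + \<gamma> + 1)) (\<alpha> + (\<gamma> + 1) + (\<beta> + \<gamma> + 1)) (of_real (1 / x\<^sup>2 * t)) n))"
  shows "core_integrand \<alpha> \<beta> \<gamma> x w =
           Gamma (\<alpha> + (\<gamma> + 1)) * Gamma (\<beta> + \<gamma> + 1) / (2 * (2 powr \<alpha>)\<^sup>2) *
           of_real x powr (- 1 - \<alpha> - \<beta> - 2 * \<gamma>) * (\<bar>- 2 * x\<^sup>2 / w ^ 3\<bar> *\<^sub>R T (x\<^sup>2 / w\<^sup>2))"
proof -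
  define t where "t = x\<^sup>2 / w\<^sup>2"
  define d e where "d = (w\<^sup>2 - x\<^sup>2) / (2 * w * x)" and "e = (w\<^sup>2 + x\<^sup>2) / (2 * w * x)"
  note * = kernel_arguments[of x w, folded d_def e_def]
  have "x\<^sup>2 < w\<^sup>2" "1 < w" using x xw by (auto intro!: power_strict_mono)
  hence pos: "0 < x" "0 < w" "0 < t" "0 < 1 - t" "0 < e" "0 < d" "(0 :: real) < 2"
    using *(1,2) x xw by (auto simp: t_def)
  have ln: "ln t = 2 * ln x - 2 * ln w" "ln d = ln w - ln x + ln (1 - t) - ln 2"
  proof -
    show "ln t = 2 * ln x - 2 * ln w" unfolding t_def using pos by (simp add: ln_div ln_realpow)
    \<comment> \<open>This 1/2, raised to 2 \<alpha> - 1, and the 2 of the Jacobian are the source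
      of \<open>(2 powr \<alpha>)\<^sup>2\<close>.\<close>
    have "d = w / x * (1 - t) / 2" using pos by (simp add: d_def t_def field_simps power2_eq_square)
    thus "ln d = ln w - ln x + ln (1 - t) - ln 2"
      using pos by (simp add: ln_div ln_mult_pos)
  qed
  define q\<^sub>0 where "q\<^sub>0 = (\<integral>q. beta_weight \<alpha> \<alpha> q * of_real (q + t * (1 - q)) powr (- (\<alpha> + \<beta>)) \<partial>lborel)"
  have se: "of_real e powr (- (\<alpha> + \<beta>)) * symmetric_euler (\<alpha> + \<beta>) \<alpha> (of_real (d / e)) =
        of_real (w / x) powr (- (\<alpha> + \<beta>)) * q\<^sub>0"
    unfolding symmetric_euler_def q\<^sub>0_def integral_mult_right_zero[symmetric]
  proof (rule Bochner_Integration.integral_cong)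
    fix q
    show "of_real e powr (- (\<alpha> + \<beta>)) *
            (beta_weight \<alpha> \<alpha> q * (1 - of_real (d / e) * of_real (1 - 2 * q)) powr (- (\<alpha> + \<beta>))) =
          of_real (w / x) powr (- (\<alpha> + \<beta>)) *
            (beta_weight \<alpha> \<alpha> q * of_real (q + t * (1 - q)) powr (- (\<alpha> + \<beta>)))"
    proof (cases "beta_weight \<alpha> \<alpha> q = 0")
      case False
      hence q: "0 < q" "q < 1" by (auto dest: beta_weight_nonzeroD)
      \<comment> \<open>Both sides are affine in q, with the values e - d = x / w at q = 0 and e + d
        = w / x at q = 1.\<close>
      have eq: "e * (1 - d / e * (1 - 2 * q)) = w / x * (q + t * (1 - q))"
      proof -
        have "e * (1 - d / e * (1 - 2 * q)) = (e - d) + 2 * d * q" using pos by (simp add: algebra_simps)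
        also have "e - d = x / w" using pos by (simp add: e_def d_def field_simps power2_eq_square)
        also have "x / w + 2 * d * q = w / x * (q + t * (1 - q))"
          using pos by (simp add: d_def t_def field_simps power2_eq_square)
        finally show ?thesis .
      qed
      have p1: "0 < q + t * (1 - q)" "0 < w / x" using q pos by (auto intro!: add_pos_pos)
      hence "0 < e * (1 - d / e * (1 - 2 * q))" unfolding eq by (intro mult_pos_pos)
      hence p2: "0 < 1 - d / e * (1 - 2 * q)" using pos by (simp add: zero_less_mult_iff)
      have "of_real e powr (- (\<alpha> + \<beta>)) * of_real (1 - d / e * (1 - 2 * q)) powr (- (\<alpha> + \<beta>)) =
            complex_of_real (e * (1 - d / e * (1 - 2 * q))) powr (- (\<alpha> + \<beta>))"
        using pos p2 unfolding of_real_mult[of e] by (intro powr_times_real[symmetric]) auto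
      also have "\<dots> = of_real (w / x) powr (- (\<alpha> + \<beta>)) * of_real (q + t * (1 - q)) powr (- (\<alpha> + \<beta>))"
        using p1 unfolding eq of_real_mult[of "w / x"] by (intro powr_times_real) auto
      finally show ?thesis by (simp add: mult_ac)
    qed simp
  qed simp
  have bc: "beta_convolution \<alpha> (\<gamma> + 1) (\<beta> + \<gamma> + 1) t =
              of_real t powr (\<beta> + \<gamma>) * of_real (1 - t) powr (2 * \<alpha> - 1) * q\<^sub>0"
  proof -
    have e: "\<gamma> + 1 - (\<beta> + \<gamma> + 1) - \<alpha> = - (\<alpha> + \<beta>)" "\<beta> + \<gamma> + 1 - 1 = \<beta> + \<gamma>" by simp_all
    have "t < 1" using pos(4) by simp
    from beta_convolution_eq[OF pos(3) this, of \<alpha> "\<gamma> + 1" "\<beta> + \<gamma> + 1"]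
    show ?thesis unfolding q\<^sub>0_def e .
  qed
  define h where "h = hyp2F1_reg (\<alpha> + (\<gamma> + 1)) (\<alpha> + (\<beta> + \<gamma> + 1)) (\<alpha> + (\<gamma> + 1) + (\<beta> + \<gamma> + 1)) (of_real (1 / w\<^sup>2))"
  have T: "T t = beta_convolution \<alpha> (\<gamma> + 1) (\<beta> + \<gamma> + 1) t * h"
  proof -
    have 1: "1 / x\<^sup>2 * t = 1 / w\<^sup>2" using pos by (simp add: t_def)
    have "hyp2F1_reg_term (\<alpha> + (\<gamma> + 1)) (\<alpha> + (\<beta> + \<gamma> + 1)) (\<alpha> + (\<gamma> + 1) + (\<beta> + \<gamma> + 1)) (of_real (1 / w\<^sup>2)) sums h"
      unfolding h_def using \<alpha> \<gamma> \<beta>\<gamma> one_less_power[OF \<open>1 < w\<close>, of 2]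
      by (intro hyp2F1_reg_sums) (auto simp: norm_divide norm_power divide_less_eq)
    from sums_unique[OF this] show ?thesis unfolding T_def 1 by simp
  qed
  have J: "jacobi_Q \<gamma> \<alpha> \<beta> (2 * (of_real w)\<^sup>2 - 1) =
           Gamma (\<alpha> + (\<gamma> + 1)) * Gamma (\<beta> + \<gamma> + 1) / 2 * of_real w powr (- 2 * (\<alpha> + \<beta> + \<gamma> + 1)) * h"
    unfolding h_def using \<alpha> \<gamma> \<beta>\<gamma> by (intro jacobi_Q_Pfaff2 \<open>1 < w\<close>) auto
  have ex: "of_real 2 = exp (complex_of_real (ln 2))" unfolding exp_of_real by simp
  have wx: "0 < w / x" "ln (w / x) = ln w - ln x" using pos by (simp_all add: ln_div)
  have abs: "\<bar>- 2 * x\<^sup>2 / w ^ 3\<bar> = exp (ln 2 + 2 * ln x - 3 * ln w)"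
  proof -
    have "exp (ln 2 + 2 * ln x - 3 * ln w) = 2 * x\<^sup>2 / w ^ 3"
      using pos exp_of_nat_mult[of 2 "ln x"] exp_of_nat_mult[of 3 "ln w"] by (simp add: exp_add exp_diff)
    thus ?thesis using pos by simp
  qed
  have pw: "of_real w powr (- 2 * (\<alpha> + \<beta> + \<gamma> + 1)) * of_real w powr (\<alpha> + \<beta>) * of_real d powr (2 * \<alpha> - 1) *
          of_real (w / x) powr (- (\<alpha> + \<beta>)) =
        of_real x powr (- 1 - \<alpha> - \<beta> - 2 * \<gamma>) * complex_of_real \<bar>- 2 * x\<^sup>2 / w ^ 3\<bar> *
        of_real t powr (\<beta> + \<gamma>) * of_real (1 - t) powr (2 * \<alpha> - 1) / (of_real 2 powr \<alpha> * of_real 2 powr \<alpha>)"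
    unfolding pos[THEN of_real_powr_exp] wx(1)[THEN of_real_powr_exp] abs exp_of_real[symmetric]
    unfolding exp_add[symmetric] exp_diff[symmetric] ln wx(2)
    by (intro arg_cong[where f = exp])
       (simp only: of_real_diff of_real_add of_real_mult of_real_numeral, simp add: algebra_simps)
  have "core_integrand \<alpha> \<beta> \<gamma> x w =
     Gamma (\<alpha> + (\<gamma> + 1)) * Gamma (\<beta> + \<gamma> + 1) / 2 * h * q\<^sub>0 *
     (of_real w powr (- 2 * (\<alpha> + \<beta> + \<gamma> + 1)) * of_real w powr (\<alpha> + \<beta>) * of_real d powr (2 * \<alpha> - 1) *
          of_real (w / x) powr (- (\<alpha> + \<beta>)))"
    unfolding core_integrand_def d_def[symmetric] e_def[symmetric] *(6)[OF pos(1) xw, symmetric]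
    unfolding J mult.assoc se by (simp only: times_divide_eq_left times_divide_eq_right mult_ac)
  also have "\<dots> = Gamma (\<alpha> + (\<gamma> + 1)) * Gamma (\<beta> + \<gamma> + 1) / (2 * (2 powr \<alpha>)\<^sup>2) *
           of_real x powr (- 1 - \<alpha> - \<beta> - 2 * \<gamma>) * (\<bar>- 2 * x\<^sup>2 / w ^ 3\<bar> *\<^sub>R T t)"
    unfolding pw T bc scaleR_conv_of_real power2_eq_square[of "_ powr _"] of_real_numeral
    by (simp only: times_divide_eq_left times_divide_eq_right divide_divide_eq_left mult_ac)
  finally show ?thesis unfolding t_def .
qed

text \<open>Under t = x^2 / w^2 the half-line becomes (0, 1) and 1 / w^2 = t / x^2, so the
  convolution lemma applies with r = 1 / x^2. Its denominator \<Gamma>(\<alpha> + \<gamma> + 1)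
  cancels against the Jacobi constant.\<close>

lemma
  fixes x :: real
  assumes \<alpha>: "Re \<alpha> > 0" and \<gamma>: "Re \<gamma> > -1" and \<beta>\<gamma>: "Re (\<gamma> + \<beta>) > -1" and x: "1 < x"
  shows set_integrable_core_integrand: "set_integrable lborel {x<..} (core_integrand \<alpha> \<beta> \<gamma> x)"
    and set_integral_core_integrand:
      "(LINT w:{x<..}|lborel. core_integrand \<alpha> \<beta> \<gamma> x w) =
         (Gamma \<alpha>)\<^sup>2 * Gamma (\<gamma> + 1) * Gamma (\<beta> + \<gamma> + 1) /
         (2 * (2 powr \<alpha>)\<^sup>2 * Gamma (\<alpha> + (\<beta> + \<gamma> + 1))) * Gamma (\<beta> + \<gamma> + 1) *
         of_real x powr (- 1 - \<alpha> - \<beta> - 2 * \<gamma>) *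
         hyp2F1_reg (\<gamma> + 1) (\<beta> + \<gamma> + 1) (\<alpha> + (\<gamma> + 1) + (\<beta> + \<gamma> + 1)) (of_real (1 / x\<^sup>2))"
proof -
  define T where "T = (\<lambda>t. beta_convolution \<alpha> (\<gamma> + 1) (\<beta> + \<gamma> + 1) t *
     (\<Sum>n. hyp2F1_reg_term (\<alpha> + (\<gamma> + 1)) (\<alpha> + (\<beta> + \<gamma> + 1)) (\<alpha> + (\<gamma> + 1) + (\<beta> + \<gamma> + 1)) (of_real (1 / x\<^sup>2 * t)) n))"
  define C where "C = Gamma (\<alpha> + (\<gamma> + 1)) * Gamma (\<beta> + \<gamma> + 1) / (2 * (2 powr \<alpha>)\<^sup>2) *
           complex_of_real x powr (- 1 - \<alpha> - \<beta> - 2 * \<gamma>)"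
  have r: "\<bar>1 / x\<^sup>2\<bar> < 1" using one_less_power[OF x, of 2] by (auto simp: divide_less_eq)
  have p: "Re (\<gamma> + 1) > 0" "Re (\<beta> + \<gamma> + 1) > 0" using \<gamma> \<beta>\<gamma> by auto
  note T = integrable_beta_convolution_hyp2F1_reg[OF \<alpha> p r, folded T_def]
           integral_beta_convolution_hyp2F1_reg[OF \<alpha> p r, folded T_def]
  have [measurable]: "T \<in> borel_measurable borel" using T(1) by auto
  define g where "g w = x\<^sup>2 / w\<^sup>2" for w
  have img: "g ` {x<..} = {0<..<1}"
  proof (intro equalityI subsetI)
    fix y assume "y \<in> g ` {x<..}"
    then obtain w where "y = x\<^sup>2 / w\<^sup>2" "x < w" by (auto simp: g_def)
    thus "y \<in> {0<..<1}" using power_strict_mono[of x w 2] x by (auto simp: divide_less_eq)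
  next
    fix y :: real assume y: "y \<in> {0<..<1}"
    hence "sqrt y < 1" "0 < sqrt y" by auto
    hence "x < x / sqrt y" using x by (simp add: field_simps)
    moreover have "g (x / sqrt y) = y" using x y by (simp add: g_def power_divide)
    ultimately show "y \<in> g ` {x<..}" by (intro image_eqI[of _ _ "x / sqrt y"]) auto
  qed
  have inj: "inj_on g {x<..}"
  proof (rule inj_onI)
    fix u v assume uv: "u \<in> {x<..}" "v \<in> {x<..}" "g u = g v"
    hence "u\<^sup>2 = v\<^sup>2" using x by (simp add: g_def field_simps)
    thus "u = v" using uv x by (simp add: power2_eq_iff)
  qed
  have der: "(g has_field_derivative - 2 * x\<^sup>2 / w ^ 3) (at w within {x<..})" if "w \<in> {x<..}" for w
    unfolding g_def using that x
    by (auto intro!: derivative_eq_intros simp: field_simps power2_eq_square power3_eq_cube)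
  have outside: "T y = 0" if "y \<notin> g ` {x<..}" for y
    using that unfolding img T_def by (auto simp: beta_convolution_outside)
  have meas: "(\<lambda>w. indicat_real {x<..} w *\<^sub>R (\<bar>- 2 * x\<^sup>2 / w ^ 3\<bar> *\<^sub>R T (g w))) \<in> borel_measurable borel"
    unfolding g_def by measurable
  have S: "{x<..} \<in> sets borel" by simp
  have sub: "set_integrable lborel {x<..} (\<lambda>w. \<bar>- 2 * x\<^sup>2 / w ^ 3\<bar> *\<^sub>R T (g w))"
            "(LINT w:{x<..}|lborel. \<bar>- 2 * x\<^sup>2 / w ^ 3\<bar> *\<^sub>R T (g w)) = integral\<^sup>L lborel T"
    by (rule set_integrable_lborel_substitution[OF S _ inj T(1) _ meas], erule der, erule outside)
       (rule set_integral_lborel_substitution[OF S _ inj T(1) _ meas], erule der, erule outside)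
  have core: "core_integrand \<alpha> \<beta> \<gamma> x w = C * (\<bar>- 2 * x\<^sup>2 / w ^ 3\<bar> *\<^sub>R T (g w))" if "w \<in> {x<..}" for w
    unfolding C_def g_def T_def using that by (intro core_integrand_eq \<alpha> \<gamma> \<beta>\<gamma> x) auto
  have "set_integrable lborel {x<..} (\<lambda>w. C * (\<bar>- 2 * x\<^sup>2 / w ^ 3\<bar> *\<^sub>R T (g w)))"
    using sub(1) by (rule set_integrable_mult_right)
  thus "set_integrable lborel {x<..} (core_integrand \<alpha> \<beta> \<gamma> x)"
    by (subst set_integrable_cong[OF refl refl core]) auto
  have "(LINT w:{x<..}|lborel. core_integrand \<alpha> \<beta> \<gamma> x w) =
          (LINT w:{x<..}|lborel. C * (\<bar>- 2 * x\<^sup>2 / w ^ 3\<bar> *\<^sub>R T (g w)))"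
    by (rule set_lebesgue_integral_cong) (use core in auto)
  also have "\<dots> = C * integral\<^sup>L lborel T"
    using sub(2) by (simp only: set_integral_mult_right)
  finally have I: "(LINT w:{x<..}|lborel. core_integrand \<alpha> \<beta> \<gamma> x w) = C * integral\<^sup>L lborel T" .
  have "Gamma (\<alpha> + (\<gamma> + 1)) \<noteq> 0" using \<alpha> \<gamma> by (intro Gamma_nonzero_if_Re_pos) auto
  thus "(LINT w:{x<..}|lborel. core_integrand \<alpha> \<beta> \<gamma> x w) =
         (Gamma \<alpha>)\<^sup>2 * Gamma (\<gamma> + 1) * Gamma (\<beta> + \<gamma> + 1) /
         (2 * (2 powr \<alpha>)\<^sup>2 * Gamma (\<alpha> + (\<beta> + \<gamma> + 1))) * Gamma (\<beta> + \<gamma> + 1) *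
         of_real x powr (- 1 - \<alpha> - \<beta> - 2 * \<gamma>) *
         hyp2F1_reg (\<gamma> + 1) (\<beta> + \<gamma> + 1) (\<alpha> + (\<gamma> + 1) + (\<beta> + \<gamma> + 1)) (of_real (1 / x\<^sup>2))"
    unfolding I T(2) C_def by (simp add: mult_ac)
qed

section \<open>Analytic continuation and the integral formula\<close>

text \<open>
  For \<open>Re z < 0\<close> the principal powers of \<open>2 z\<^sup>2 - 2\<close> and \<open>2 z\<^sup>2\<close> are the wrong branches; splitting them
  into powers of \<open>z - 1\<close>, \<open>z + 1\<close> and \<open>z\<close> gives the continuation.
\<close>

lemma jacobi_Q_continuation:
  assumes "Re (\<alpha> + \<gamma> + 1) > 0" "Re (\<beta> + \<gamma> + 1) > 0"
  shows "\<exists>L. continues L (\<lambda>x. jacobi_Q \<gamma> \<alpha> \<beta> (2 * (complex_of_real x)\<^sup>2 - 1))"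
proof -
  define h where "h = hyp2F1_reg (\<gamma> + 1) (\<alpha> + \<gamma> + 1) (\<alpha> + \<beta> + 2 * \<gamma> + 2)"
  have hol: "h holomorphic_on gauss_cut"
    unfolding h_def by (rule holomorphic_on_hyp2F1_reg) (use assms in \<open>auto simp: algebra_simps\<close>)
  define L where "L z = Gamma (\<alpha> + \<gamma> + 1) * Gamma (\<beta> + \<gamma> + 1) / 2 *
     ((z - 1) powr (- (\<alpha> + \<gamma> + 1)) * (z + 1) powr (- (\<alpha> + \<gamma> + 1)) * z powr (- 2 * \<beta>)) *
     h (1 / (1 - z\<^sup>2))" for z
  have cut: "1 - z\<^sup>2 \<noteq> 0" "1 / (1 - z\<^sup>2) \<in> gauss_cut" "z \<notin> \<real>\<^sub>\<le>\<^sub>0" "z - 1 \<notin> \<real>\<^sub>\<le>\<^sub>0" "z + 1 \<notin> \<real>\<^sub>\<le>\<^sub>0"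
    if "z \<in> cut_plane" for z
  proof -
    have z: "\<not> (Im z = 0 \<and> Re z \<le> 1)"
      using that by (auto simp: cut_plane_def image_iff complex_eq_iff)
    thus "z \<notin> \<real>\<^sub>\<le>\<^sub>0" "z - 1 \<notin> \<real>\<^sub>\<le>\<^sub>0" "z + 1 \<notin> \<real>\<^sub>\<le>\<^sub>0" by (auto simp: complex_nonpos_Reals_iff)
    \<comment> \<open>Both ways of leaving the domain of h make z^2 a real number in [0, 1]: it is
      1, or 1 - 1 / r with r \<ge> 1.\<close>
    have *: False if "z\<^sup>2 = of_real s" "0 \<le> s" "s \<le> 1" for s :: real
    proof -
      have "z\<^sup>2 = (of_real (sqrt s))\<^sup>2" using that by (simp flip: of_real_power)
      hence "z = of_real (sqrt s) \<or> z = - of_real (sqrt s)" by (simp only: power2_eq_iff)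
      moreover have "sqrt s \<le> 1" "- sqrt s \<le> 1" using that by (auto intro: order.trans[of _ 0])
      ultimately show False using z by auto
    qed
    show "1 - z\<^sup>2 \<noteq> 0" using *[of 1] by auto
    show "1 / (1 - z\<^sup>2) \<in> gauss_cut"
    proof
      assume "1 / (1 - z\<^sup>2) \<in> complex_of_real ` {1..}"
      then obtain r where r: "1 / (1 - z\<^sup>2) = of_real r" "1 \<le> r" by auto
      hence "z\<^sup>2 = of_real (1 - 1 / r)" using \<open>1 - z\<^sup>2 \<noteq> 0\<close> by (auto simp: field_simps)
      from *[OF this] r(2) show False by auto
    qed
  qed
  have "(\<lambda>z. h (1 / (1 - z\<^sup>2))) holomorphic_on cut_plane"
    by (rule holomorphic_on_compose_gen[OF _ hol, unfolded o_def])
       (use cut in \<open>auto intro!: holomorphic_intros simp del: ComplI\<close>)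
  hence "L holomorphic_on cut_plane"
    unfolding L_def by (intro holomorphic_intros) (use cut in auto)
  moreover have "L (of_real x) = jacobi_Q \<gamma> \<alpha> \<beta> (2 * (of_real x)\<^sup>2 - 1)" if x: "x > 1" for x
  proof -
    have pos: "0 < x" "0 < x - 1" "0 < x + 1" "0 < x\<^sup>2" "0 < x\<^sup>2 - 1"
      using x one_less_power[OF x, of 2] by auto
    have "x\<^sup>2 - 1 = (x - 1) * (x + 1)" by algebra
    hence ln: "ln (x\<^sup>2 - 1) = ln (x - 1) + ln (x + 1)" "ln (x\<^sup>2) = 2 * ln x"
      using pos by (simp_all add: ln_mult_pos ln_realpow)
    have "of_real (x - 1) powr (- (\<alpha> + \<gamma> + 1)) * of_real (x + 1) powr (- (\<alpha> + \<gamma> + 1)) * of_real x powr (- 2 * \<beta>) =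
          complex_of_real (x\<^sup>2 - 1) powr (- (\<alpha> + \<gamma> + 1)) * of_real (x\<^sup>2) powr (- \<beta>)"
      unfolding pos[THEN of_real_powr_exp]
      unfolding exp_add[symmetric] ln
      by (intro arg_cong[where f = exp]) (simp only: of_real_add of_real_mult, simp add: algebra_simps)
    thus ?thesis unfolding L_def jacobi_Q_real[OF x] h_def by (simp add: mult.assoc)
  qed
  ultimately show ?thesis unfolding continues_def by blast
qed

text \<open>One L, the continuation of the left-hand side, is compared with the continuations of
  both right-hand sides. Integrability belongs to the claim because a non-integrable function has
  integral 0 by default. The conditions on \<alpha> + \<beta> and, for the Gegenbauer form, on
  \<beta> + 1/2 say that these Gamma factors are defined: at its poles \<open>Gamma\<close> has the
  value 0.\<close>

theorem theorem46:
  fixes \<alpha> \<beta> \<gamma> :: complex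
  assumes "\<alpha> \<noteq> 0" and "\<beta> \<noteq> 0" and "\<gamma> \<noteq> 0"
    and "Re \<alpha> > 0" and "Re \<gamma> > -1" and "Re (\<gamma> + \<beta>) > -1" and "\<beta> \<noteq> - 1 / 2"
    and "\<forall>n::nat. n \<ge> 1 \<longrightarrow> \<alpha> + \<gamma> \<noteq> - of_nat n"
    and "\<forall>n::nat. n \<ge> 1 \<longrightarrow> \<alpha> + \<beta> + \<gamma> \<noteq> - of_nat n"
    and Gamma_defined: "\<alpha> + \<beta> \<notin> \<int>\<^sub>\<le>\<^sub>0"
  shows
    "\<exists>L. continues L (\<lambda>x. jacobi_Q \<gamma> \<alpha> \<beta> (2 * (complex_of_real x)\<^sup>2 - 1)) \<and>
      (\<beta> + 1 / 2 \<notin> \<int>\<^sub>\<le>\<^sub>0 \<longrightarrow>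
        (\<forall>x>1. set_integrable lborel {x<..}
                 (\<lambda>w. gegenbauer_integrand \<alpha> \<beta> \<gamma> (complex_of_real x) (complex_of_real w))) \<and>
        (\<exists>R. continues R
               (\<lambda>x. exp (- \<i> * of_real pi * (\<beta> + 1 / 2)) * 2 powr (\<alpha> + \<beta> + 1) * of_real (sqrt pi) *
                    Gamma (\<beta> + 1 / 2) * Gamma (\<alpha> + \<gamma> + 1) * Gamma (\<alpha> + \<beta> + \<gamma> + 1) *
                    complex_of_real x powr (\<alpha> - \<beta> - 1) /
                    (Gamma \<alpha> * Gamma (\<gamma> + 1) * Gamma (\<alpha> + \<beta>) * Gamma (\<beta> + \<gamma> + 1) *
                     ((complex_of_real x)\<^sup>2 - 1) powr \<alpha>) *
                    (LINT w:{x<..}|lborel.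
                       gegenbauer_integrand \<alpha> \<beta> \<gamma> (complex_of_real x) (complex_of_real w))) \<and>
             (\<forall>z\<in>cut_plane. L z = R z))) \<and>
      (\<forall>x>1. set_integrable lborel {x<..}
               (\<lambda>w. legendre_integrand \<alpha> \<beta> \<gamma> (complex_of_real x) (complex_of_real w))) \<and>
      (\<exists>R. continues R
             (\<lambda>x. exp (- \<i> * of_real pi * \<beta>) * 2 powr (\<alpha> + 1) *
                  Gamma (\<alpha> + \<gamma> + 1) * Gamma (\<alpha> + \<beta> + \<gamma> + 1) *
                  complex_of_real x powr (\<alpha> - \<beta> - 1) /
                  (Gamma \<alpha> * Gamma (\<gamma> + 1) * Gamma (\<alpha> + \<beta>) * Gamma (\<beta> + \<gamma> + 1) *
                   ((complex_of_real x)\<^sup>2 - 1) powr \<alpha>) *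
                  (LINT w:{x<..}|lborel.
                     legendre_integrand \<alpha> \<beta> \<gamma> (complex_of_real x) (complex_of_real w))) \<and>
           (\<forall>z\<in>cut_plane. L z = R z))"
proof -
  note \<alpha> = \<open>Re \<alpha> > 0\<close> and \<gamma> = \<open>Re \<gamma> > -1\<close> and \<beta>\<gamma> = \<open>Re (\<gamma> + \<beta>) > -1\<close>
  have assoc: "\<alpha> + \<gamma> + 1 = \<alpha> + (\<gamma> + 1)" "\<alpha> + \<beta> + \<gamma> + 1 = \<alpha> + (\<beta> + \<gamma> + 1)" by (simp_all add: add_ac)
  have Re: "Re (\<alpha> + \<gamma> + 1) > 0" "Re (\<beta> + \<gamma> + 1) > 0" using \<alpha> \<gamma> \<beta>\<gamma> by auto
  have nz: "Gamma \<alpha> \<noteq> 0" "Gamma (\<gamma> + 1) \<noteq> 0" "Gamma (\<beta> + \<gamma> + 1) \<noteq> 0"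
           "Gamma (\<alpha> + (\<beta> + \<gamma> + 1)) \<noteq> 0"
    using \<alpha> \<gamma> \<beta>\<gamma> by (intro Gamma_nonzero_if_Re_pos; simp)+
  have nz': "Gamma (\<alpha> + \<beta>) \<noteq> 0" using Gamma_defined by (simp add: Gamma_eq_zero_iff)
  have four: "(4 :: complex) powr \<alpha> = (2 powr \<alpha>)\<^sup>2"
    using powr_times_real[of 2 2 \<alpha>] by (simp add: power2_eq_square)
  \<comment> \<open>P is what the two prefactors share; the rest of each combines with the constant
    of its kernel to the factor displayed in \<open>key\<close>.\<close>
  define P where "P x = 2 * Gamma (\<alpha> + \<gamma> + 1) * Gamma (\<alpha> + \<beta> + \<gamma> + 1) * complex_of_real x powr (\<alpha> - \<beta> - 1) /
     (Gamma \<alpha> * Gamma (\<gamma> + 1) * Gamma (\<alpha> + \<beta>) * Gamma (\<beta> + \<gamma> + 1) * ((complex_of_real x)\<^sup>2 - 1) powr \<alpha>)" for x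
  have key: "P x * Gamma (\<alpha> + \<beta>) * (2 powr \<alpha>)\<^sup>2 / (2 * Gamma \<alpha>) *
               (LINT w:{x<..}|lborel. core_integrand \<alpha> \<beta> \<gamma> x w) =
             jacobi_Q \<gamma> \<alpha> \<beta> (2 * (complex_of_real x)\<^sup>2 - 1)" if x: "x > 1" for x
  proof -
    \<comment> \<open>The power of x in the prefactor and the one left by the integral combine to
      the power in \<open>jacobi_Q_Pfaff1\<close>.\<close>
    have "of_real x powr (\<alpha> - \<beta> - 1) * of_real x powr (- 1 - \<alpha> - \<beta> - 2 * \<gamma>) =
          complex_of_real x powr (- 2 * (\<beta> + \<gamma> + 1))"
      unfolding powr_add[symmetric] by (simp add: algebra_simps)
    hence pw: "complex_of_real x powr (- 2 * (\<beta> + \<gamma> + 1)) =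
          of_real x powr (\<alpha> - \<beta> - 1) * of_real x powr (- 1 - \<alpha> - \<beta> - 2 * \<gamma>)" ..
    have pw': "complex_of_real (x\<^sup>2 - 1) powr (- \<alpha>) = 1 / ((of_real x)\<^sup>2 - 1) powr \<alpha>"
      by (simp add: powr_minus_divide)
    show ?thesis
      unfolding set_integral_core_integrand[OF \<alpha> \<gamma> \<beta>\<gamma> x] jacobi_Q_Pfaff1[OF x Re] P_def assoc pw pw'
      using nz nz' by (simp add: power2_eq_square mult_ac)
  qed
  have cong: "legendre_integrand \<alpha> \<beta> \<gamma> (of_real x) (of_real w) =
           of_real (sqrt pi) * exp (\<i> * of_real pi * \<beta>) * Gamma (\<alpha> + \<beta>) / 2 powr \<alpha> *
           (4 powr \<alpha> / (2 * of_real (sqrt pi) * Gamma \<alpha>)) * core_integrand \<alpha> \<beta> \<gamma> x w"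
       "gegenbauer_integrand \<alpha> \<beta> \<gamma> (of_real x) (of_real w) =
           exp (\<i> * of_real pi * (\<beta> + 1 / 2)) * Gamma (\<alpha> + \<beta>) / (Gamma (\<beta> + 1 / 2) * 2 powr (\<alpha> + \<beta>)) *
           (4 powr \<alpha> / (2 * of_real (sqrt pi) * Gamma \<alpha>)) * core_integrand \<alpha> \<beta> \<gamma> x w"
    if "1 < x" "w \<in> {x<..}" for x w
    by (rule legendre_integrand_eq[OF \<alpha>]; use that in simp)
       (rule gegenbauer_integrand_eq[OF \<alpha>]; use that in simp)
  have integrable: "set_integrable lborel {x<..} (\<lambda>w. legendre_integrand \<alpha> \<beta> \<gamma> (of_real x) (of_real w))"
                   "set_integrable lborel {x<..} (\<lambda>w. gegenbauer_integrand \<alpha> \<beta> \<gamma> (of_real x) (of_real w))"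
    if x: "x > 1" for x
    using set_integrable_core_integrand[OF \<alpha> \<gamma> \<beta>\<gamma> x]
    by (subst set_integrable_cong[OF refl refl cong(1)[OF x]], auto)
       (subst set_integrable_cong[OF refl refl cong(2)[OF x]], auto)
  have integral1:
       "(LINT w:{x<..}|lborel. legendre_integrand \<alpha> \<beta> \<gamma> (of_real x) (of_real w)) =
          of_real (sqrt pi) * exp (\<i> * of_real pi * \<beta>) * Gamma (\<alpha> + \<beta>) / 2 powr \<alpha> *
          (4 powr \<alpha> / (2 * of_real (sqrt pi) * Gamma \<alpha>)) * (LINT w:{x<..}|lborel. core_integrand \<alpha> \<beta> \<gamma> x w)"
          (is "?I1 = ?K1 * _")
    and integral2:
       "(LINT w:{x<..}|lborel. gegenbauer_integrand \<alpha> \<beta> \<gamma> (of_real x) (of_real w)) =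
          exp (\<i> * of_real pi * (\<beta> + 1 / 2)) * Gamma (\<alpha> + \<beta>) / (Gamma (\<beta> + 1 / 2) * 2 powr (\<alpha> + \<beta>)) *
          (4 powr \<alpha> / (2 * of_real (sqrt pi) * Gamma \<alpha>)) * (LINT w:{x<..}|lborel. core_integrand \<alpha> \<beta> \<gamma> x w)"
          (is "?I2 = ?K2 * _")
    if x: "x > 1" for x
  proof -
    have "?I1 = (LINT w:{x<..}|lborel. ?K1 * core_integrand \<alpha> \<beta> \<gamma> x w)"
      by (rule set_lebesgue_integral_cong) (simp, use cong(1)[OF x] in blast)
    thus "?I1 = ?K1 * (LINT w:{x<..}|lborel. core_integrand \<alpha> \<beta> \<gamma> x w)"
      by (simp only: set_integral_mult_right)
    have "?I2 = (LINT w:{x<..}|lborel. ?K2 * core_integrand \<alpha> \<beta> \<gamma> x w)"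
      by (rule set_lebesgue_integral_cong) (simp, use cong(2)[OF x] in blast)
    thus "?I2 = ?K2 * (LINT w:{x<..}|lborel. core_integrand \<alpha> \<beta> \<gamma> x w)"
      by (simp only: set_integral_mult_right)
  qed
  obtain L where L: "continues L (\<lambda>x. jacobi_Q \<gamma> \<alpha> \<beta> (2 * (complex_of_real x)\<^sup>2 - 1))"
    using jacobi_Q_continuation[OF Re] by blast
  \<comment> \<open>Both right-hand sides equal the Jacobi function on (1, \<infinity>), so L itself
    continues either of them.\<close>
  have transfer: "\<exists>R. continues R f \<and> (\<forall>z\<in>cut_plane. L z = R z)"
    if "\<And>x. x > 1 \<Longrightarrow> f x = jacobi_Q \<gamma> \<alpha> \<beta> (2 * (complex_of_real x)\<^sup>2 - 1)" for f
    using L that by (intro exI[of _ L]) (simp add: continues_def)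
  show ?thesis
  proof (rule exI[of _ L], intro conjI L impI allI integrable transfer)
    fix x :: real assume x: "x > 1" and "\<beta> + 1 / 2 \<notin> \<int>\<^sub>\<le>\<^sub>0"
    hence nz'': "Gamma (\<beta> + 1 / 2) \<noteq> 0" by (simp add: Gamma_eq_zero_iff)
    have ex: "exp (- \<i> * of_real pi * (\<beta> + 1 / 2)) = 1 / exp (\<i> * of_real pi * (\<beta> + 1 / 2))"
      by (simp add: exp_minus inverse_eq_divide)
    have p2: "(2 :: complex) powr (\<alpha> + \<beta> + 1) = 2 * 2 powr (\<alpha> + \<beta>)" by (simp add: powr_add)
    show "exp (- \<i> * of_real pi * (\<beta> + 1 / 2)) * 2 powr (\<alpha> + \<beta> + 1) * of_real (sqrt pi) *
                    Gamma (\<beta> + 1 / 2) * Gamma (\<alpha> + \<gamma> + 1) * Gamma (\<alpha> + \<beta> + \<gamma> + 1) *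
                    complex_of_real x powr (\<alpha> - \<beta> - 1) /
                    (Gamma \<alpha> * Gamma (\<gamma> + 1) * Gamma (\<alpha> + \<beta>) * Gamma (\<beta> + \<gamma> + 1) *
                     ((complex_of_real x)\<^sup>2 - 1) powr \<alpha>) *
                    (LINT w:{x<..}|lborel.
                       gegenbauer_integrand \<alpha> \<beta> \<gamma> (complex_of_real x) (complex_of_real w)) =
          jacobi_Q \<gamma> \<alpha> \<beta> (2 * (complex_of_real x)\<^sup>2 - 1)"
      unfolding key[OF x, symmetric] integral2[OF x] P_def ex p2 four using nz'' by simp
  next
    fix x :: real assume x: "x > 1"
    have ex: "exp (- \<i> * of_real pi * \<beta>) = 1 / exp (\<i> * of_real pi * \<beta>)"
      by (simp add: exp_minus inverse_eq_divide)
    have p2: "(2 :: complex) powr (\<alpha> + 1) = 2 * 2 powr \<alpha>" by (simp add: powr_add)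
    show "exp (- \<i> * of_real pi * \<beta>) * 2 powr (\<alpha> + 1) *
                  Gamma (\<alpha> + \<gamma> + 1) * Gamma (\<alpha> + \<beta> + \<gamma> + 1) *
                  complex_of_real x powr (\<alpha> - \<beta> - 1) /
                  (Gamma \<alpha> * Gamma (\<gamma> + 1) * Gamma (\<alpha> + \<beta>) * Gamma (\<beta> + \<gamma> + 1) *
                   ((complex_of_real x)\<^sup>2 - 1) powr \<alpha>) *
                  (LINT w:{x<..}|lborel.
                     legendre_integrand \<alpha> \<beta> \<gamma> (complex_of_real x) (complex_of_real w)) =
          jacobi_Q \<gamma> \<alpha> \<beta> (2 * (complex_of_real x)\<^sup>2 - 1)"
      unfolding key[OF x, symmetric] integral1[OF x] P_def ex p2 four by simp
  qed (use L in auto)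
qed

end
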